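(* Consider the probit extended bifactor model and let $(A,\mathbf d,\Sigma_G)\in\mathfrak P$. The model is identifiable at $(A,\mathbf d,\Sigma_G)$ if at least one of the following two conditions holds: (E1S) $|\mathcal Q_g|\ge 3$ for all $g=1,\dots,G$, and $|\mathcal H_3|\ge 3$; (E2S) $|\mathcal Q_g|\ge 3$ for all $g=1,\dots,G$, $|\mathcal H_3|=2$, and $|\mathcal H_2|\ge 1$.
   Context: Probit extended bifactor model. Fix $G\ge 1$ and items $\{1,\dots,J\}$ with a fixed known partition into $G$ nonempty testlets $\mathcal B_1,\dots,\mathcal B_G$; $g_j$ is the testlet containing item $j$. Parameters: a real $J\times(1+G)$ loading matrix $A=[\mathbf a_0,\mathbf a_1,\dots,\mathbf a_G]$ with $\mathbf a_g[j]=0$ whenever $g\ge1$ and $g\ne g_j$ (the other entries are arbitrary reals, possibly zero); intercepts $\mathbf d\in\mathbb R^J$; a $G\times G$ symmetric positive definite matrix $\Sigma_G$ with all diagonal entries equal to 1. The observed responses $Y_1,\dots,Y_J\in\{0,1\}$ are conditionally independent given $\boldsymbol\eta=(\eta_0,\eta_1,\dots,\eta_G)^T\sim N(\mathbf 0,\Sigma)$, $\Sigma=\begin{pmatrix}1&\mathbf 0^T\\ \mathbf 0&\Sigma_G\end{pmatrix}$, with $$P(Y_j=1\mid\boldsymbol\eta)=\Phi\big(d_j+\mathbf a_0[j]\,\eta_0+\mathbf a_{g_j}[j]\,\eta_{g_j}\big),$$ where $\Phi$ is the standard normal distribution function. The parameter space $\mathfrak P$ is the set of all such $(A,\mathbf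 d,\Sigma_G)$ for which the first nonzero entry of every column of $A$ is positive (no requirement on a zero column). The model is identifiable at $(A,\mathbf d,\Sigma_G)\in\mathfrak P$ if every $(A',\mathbf d',\Sigma_G')\in\mathfrak P$ that defines the same (marginal) distribution of $(Y_1,\dots,Y_J)$ equals $(A,\mathbf d,\Sigma_G)$. Notation: $x[\mathcal B]$ is the subvector of $x$ with entries in $\mathcal B$; $M[\mathcal B,:]$ is the submatrix of rows indexed by $\mathcal B$; $\bar A_g=(\mathbf a_0[\mathcal B_g],\mathbf a_g[\mathcal B_g])$ is the $|\mathcal B_g|\times 2$ matrix of main and testlet loadings of testlet $g$ (rows indexed by $\mathcal B_g$). - $\mathcal Q_g=\{j:\mathbf a_g[j]\ne 0\}$ for $g=1,\dots,G$. - $\mathcal H_2$ is the set of $g\in\{1,\dots,G\}$ for which there is a partition $\mathcal B_g=\mathcal B_{g,1}\cup\mathcal B_{g,2}$, $\mathcal B_{g,1}\cap\mathcal B_{g,2}=\emptyset$, such that both $\bar A_g[\mathcal B_{g,1},:]$ and $\bar A_g[\mathcal B_{g,2},:]$ have full column rank (rank 2). - $\mathcal H_3=\{g\in\{1,\dots,G\}:\bar A_g\text{ has column rank }2\}$. *)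

theory Defs
  imports "HOL-Probability.Probability"
begin

text \<open>
  Conventions. Items are the elements of a finite linearly ordered type \<open>'j\<close> (that is,
  \<open>1 < \<dots> < J\<close>; the order matters only for the sign convention on the columns), testlets
  are the elements of a finite type \<open>'g\<close>. The testlet partition is given by the map
  \<open>gof\<close> sending an item \<open>j\<close> to its testlet \<open>g\<^sub>j\<close>; nonemptiness of the testlets is
  \<open>surj gof\<close>. The \<open>1 + G\<close> latent dimensions are indexed by \<open>'g option\<close>: \<open>None\<close> is the
  main dimension \<open>0\<close>, \<open>Some g\<close> is the testlet dimension \<open>g\<close>.
\<close>

definition testlet :: "('j \<Rightarrow> 'g) \<Rightarrow> 'g \<Rightarrow> 'j set" where
  "testlet gof g = {j. gof j = g}"

type_synonym ('j, 'g) params =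
  "((real, 'g option) vec, 'j) vec \<times> (real, 'j) vec \<times> ((real, 'g) vec, 'g) vec"

subsection \<open>The model\<close>

definition pos_def_matrix :: "real^'n^'n \<Rightarrow> bool" where
  "pos_def_matrix S \<longleftrightarrow> transpose S = S \<and> (\<forall>x. x \<noteq> 0 \<longrightarrow> x \<bullet> (S *v x) > 0)"

text \<open>The centred multivariate normal distribution; meaningful for positive definite \<open>S\<close>.\<close>

definition mvn_density :: "real^'n^'n \<Rightarrow> real^'n \<Rightarrow> real" where
  "mvn_density S x =
     exp (- (x \<bullet> (matrix_inv S *v x)) / 2) / sqrt ((2 * pi) ^ CARD('n) * det S)"

definition mvn :: "real^'n^'n \<Rightarrow> (real^'n) measure" where
  "mvn S = density lborel (\<lambda>x. ennreal (mvn_density S x))"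

definition full_cov :: "real^('g::finite)^'g \<Rightarrow> real^('g option)^('g option)" where
  "full_cov SG = (\<chi> k l. case (k, l) of
      (None, None) \<Rightarrow> 1
    | (Some g, Some h) \<Rightarrow> SG $ g $ h
    | _ \<Rightarrow> 0)"

definition std_normal_cdf :: "real \<Rightarrow> real" where
  "std_normal_cdf = cdf std_normal_distribution"

text \<open>
  A response vector is a function \<open>y :: 'j \<Rightarrow> bool\<close>, with \<open>True\<close> for the response \<open>1\<close>.
  Conditional independence given \<open>eta\<close> is the product of the item distributions.
\<close>

definition cond_response_pmf ::
  "('j::finite \<Rightarrow> 'g::finite) \<Rightarrow> real^('g option)^'j \<Rightarrow> real^'j \<Rightarrow> real^('g option) \<Rightarrow> ('j \<Rightarrow> bool) pmf"
where
  "cond_response_pmf gof A d eta = Pi_pmf UNIV False (\<lambda>j. bernoulli_pmf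
     (std_normal_cdf (d $ j + A $ j $ None * eta $ None + A $ j $ Some (gof j) * eta $ Some (gof j))))"

definition response_distribution ::
  "('j::finite \<Rightarrow> 'g::finite) \<Rightarrow> ('j, 'g) params \<Rightarrow> ('j \<Rightarrow> bool) measure"
where
  "response_distribution gof = (\<lambda>(A, d, SG).
     mvn (full_cov SG) \<bind> (\<lambda>eta. measure_pmf (cond_response_pmf gof A d eta)))"

subsection \<open>Parameter space and identifiability\<close>

definition first_nonzero_pos :: "real^('j::{finite,linorder}) \<Rightarrow> bool" where
  "first_nonzero_pos v \<longleftrightarrow> (\<forall>j. v $ j \<noteq> 0 \<and> (\<forall>i<j. v $ i = 0) \<longrightarrow> v $ j > 0)"

definition param_space ::
  "('j::{finite,linorder} \<Rightarrow> 'g::finite) \<Rightarrow> ('j, 'g) params set"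
where
  "param_space gof = {(A, d, SG).
     (\<forall>j g. g \<noteq> gof j \<longrightarrow> A $ j $ Some g = 0) \<and>
     pos_def_matrix SG \<and> (\<forall>g. SG $ g $ g = 1) \<and>
     (\<forall>k. first_nonzero_pos (column k A))}"

definition identifiable_at ::
  "('j::{finite,linorder} \<Rightarrow> 'g::finite) \<Rightarrow> ('j, 'g) params \<Rightarrow> bool"
where
  "identifiable_at gof p \<longleftrightarrow>
     (\<forall>p' \<in> param_space gof. response_distribution gof p' = response_distribution gof p \<longrightarrow> p' = p)"

subsection \<open>Conditions on the loadings\<close>

text \<open>
  The two-column matrix of main and testlet-\<open>g\<close> loadings with rows in \<open>B\<close>. Since the row
  index type is fixed, rows outside \<open>B\<close> are replaced by zero rows instead of being deleted;
  this does not change the rank.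
\<close>

definition loading_submatrix :: "real^(('g::finite) option)^'j \<Rightarrow> 'g \<Rightarrow> 'j set \<Rightarrow> real^2^'j" where
  "loading_submatrix A g B =
     (\<chi> j. if j \<in> B then vector [A $ j $ None, A $ j $ Some g] else 0)"

definition Q_set :: "real^(('g::finite) option)^'j \<Rightarrow> 'g \<Rightarrow> 'j set" where
  "Q_set A g = {j. A $ j $ Some g \<noteq> 0}"

definition H2_set :: "('j \<Rightarrow> 'g::finite) \<Rightarrow> real^(('g::finite) option)^'j \<Rightarrow> 'g set" where
  "H2_set gof A = {g. \<exists>B1 B2. B1 \<union> B2 = testlet gof g \<and> B1 \<inter> B2 = {} \<and>
     rank (loading_submatrix A g B1) = 2 \<and> rank (loading_submatrix A g B2) = 2}"

definition H3_set :: "('j \<Rightarrow> 'g::finite) \<Rightarrow> real^(('g::finite) option)^'j \<Rightarrow> 'g set" where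
  "H3_set gof A = {g. rank (loading_submatrix A g (testlet gof g)) = 2}"

end

theory Submission
  imports Defs
begin

text \<open>
  A probit response is a thresholded Gaussian: with independent standard normal noise
  \<open>e\<^sub>j\<close>, the response \<open>j\<close> is correct iff
  \<open>e\<^sub>j \<le> d\<^sub>j + \<langle>A\<^sub>j, \<eta>\<rangle>\<close>. Hence the joint law of two responses is an orthant
  probability of a bivariate normal distribution. Dividing by the standard deviation
  \<open>v\<^sub>j = sqrt (1 + var \<langle>A\<^sub>j, \<eta>\<rangle>)\<close>, it depends only on the standardised thresholds
  \<open>d\<^sub>j / v\<^sub>j\<close> and on the correlation of the two underlying variables, and it determines
  all of them. Equal response distributions therefore have equal
  standardised thresholds and equal correlations for all pairs of distinct items
  (\<open>response_determines_polychoric\<close>). The correlations are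
  \<open>x\<^sub>i x\<^sub>j + \<sigma>(g\<^sub>i, g\<^sub>j) y\<^sub>i y\<^sub>j\<close> with \<open>x = a\<^sub>0 / v\<close> and \<open>y = a\<^sub>g / v\<close>, and
  \<open>x\<^sub>j\<^sup>2 + y\<^sub>j\<^sup>2 = 1 - 1 / v\<^sub>j\<^sup>2\<close> recovers \<open>v\<^sub>j\<close>. So everything reduces to an
  algebraic question: do the off-diagonal correlations determine \<open>x\<close>, \<open>y\<close> and
  \<open>\<sigma>\<close> up to the signs of the columns?

  The analytic half needs only integrals of functions of two linear functionals. A
  Gram-Schmidt basis for the covariance form that starts with these two functionals turns the
  normal density into the standard one, up to a constant factor. That factor need not be
  computed: it is the total mass, and it cancels when two response distributions are compared.
  The bivariate orthant probability is then reached by a rotation of the plane. It is injective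
  in the correlation because the conditional probabilities for two different correlations, as
  functions of the conditioning variable, have the same mean and cross exactly once.

  For the algebraic half let \<open>x', y', \<sigma>'\<close> be a competing solution. It is enough to find one
  testlet whose rows \<open>(x\<^sub>j, y\<^sub>j)\<close> span the plane and on which \<open>x' = \<plusminus> x\<close>: the
  correlations with this testlet then fix \<open>x'\<close> everywhere, and three nonzero testlet
  loadings per testlet fix \<open>y'\<close> up to sign (\<open>all_agree_up_to_sign\<close>). Two spanning
  testlets \<open>g, h\<close> with \<open>\<sigma>(g, h) \<noteq> 0\<close> force \<open>(x', y')\<close> to be a linear image of
  \<open>(x, y)\<close> on each of them, by matrices \<open>R\<^sub>g\<close>, \<open>R\<^sub>h\<close> with
  \<open>R\<^sub>g diag(1, \<sigma>'(g, h)) R\<^sub>h\<^sup>T = diag(1, \<sigma>(g, h))\<close>. The correlations inside the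
  testlet say that the quadratic form \<open>R\<^sub>g R\<^sub>g\<^sup>T - 1\<close> vanishes on all pairs of distinct
  rows, which makes it singular (\<open>quadratic_form_singular\<close>). With three spanning testlets,
  eliminating \<open>R\<^sub>h\<close> and \<open>R\<^sub>k\<close> gives
  \<open>R\<^sub>g diag(1, \<kappa>') R\<^sub>g\<^sup>T = diag(1, \<kappa>)\<close> where
  \<open>\<kappa> = \<sigma>(g, h) \<sigma>(g, k) / \<sigma>(h, k)\<close>, and together with singularity this makes
  \<open>R\<^sub>g\<close> diagonal unless \<open>\<kappa> = 1\<close>. At most one of the three testlets can have
  \<open>\<kappa> = 1\<close>, because the product of the values of \<open>\<kappa>\<close> for \<open>g\<close> and \<open>h\<close> is
  \<open>\<sigma>(g, h)\<^sup>2 < 1\<close>. With two spanning testlets, a splitting of the first one into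
  spanning halves makes \<open>R\<^sub>g\<close> orthogonal, and singularity at the second one makes it
  diagonal. Vanishing covariances \<open>\<sigma>(g, h) = 0\<close> are treated separately; there \<open>x'\<close>
  is \<open>t x\<close> on \<open>g\<close> and \<open>x / t\<close> on \<open>h\<close>, and a third testlet, or the
  splitting, gives \<open>t\<^sup>2 = 1\<close>.
\<close>

section \<open>Linear substitution in Gaussian integrals\<close>

text \<open>
  Uniqueness of Haar measure in its elementary form: the measure of the pairs \<open>(x, y)\<close> with
  \<open>x \<in> A\<close> and \<open>x + y \<in> B\<close> is computed in both orders of integration.
\<close>

lemma translation_invariant_measure_unique:
  fixes M :: "'a::euclidean_space measure"
  assumes sM[measurable_cong]: "sets M = sets borel" and sf: "sigma_finite_measure M"
    and inv: "\<And>a. distr M borel (\<lambda>x. x + a) = M"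
    and A[measurable]: "A \<in> sets borel" and B[measurable]: "B \<in> sets borel"
  shows "emeasure M A * emeasure lborel B = emeasure M B * emeasure lborel A"
proof -
  interpret M: sigma_finite_measure M by fact
  interpret P: pair_sigma_finite M "lborel :: 'a measure" by standard
  have transM: "(\<integral>\<^sup>+x. f (x + a) \<partial>M) = (\<integral>\<^sup>+x. f x \<partial>M)"
    if [measurable]: "f \<in> borel_measurable borel" for f :: "'a \<Rightarrow> ennreal" and a
  proof -
    have "(\<integral>\<^sup>+x. f x \<partial>M) = (\<integral>\<^sup>+x. f x \<partial>distr M borel (\<lambda>x. x + a))" by (simp only: inv)
    also have "\<dots> = (\<integral>\<^sup>+x. f (x + a) \<partial>M)" by (intro nn_integral_distr) measurable
    finally show ?thesis by simp
  qed
  have transL: "(\<integral>\<^sup>+y. f (a + y) \<partial>lborel) = (\<integral>\<^sup>+y. f y \<partial>lborel)"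
    if [measurable]: "f \<in> borel_measurable borel" for f :: "'a \<Rightarrow> ennreal" and a
  proof -
    have "(\<integral>\<^sup>+x. f x \<partial>lborel) = (\<integral>\<^sup>+x. f x \<partial>distr lborel borel ((+) a))" by (simp only: lborel_distr_plus)
    also have "\<dots> = (\<integral>\<^sup>+x. f (a + x) \<partial>lborel)" by (intro nn_integral_distr) measurable
    finally show ?thesis by simp
  qed
  have reflL: "(\<integral>\<^sup>+y. f (a - y) \<partial>lborel) = (\<integral>\<^sup>+y. f y \<partial>lborel)"
    if [measurable]: "f \<in> borel_measurable borel" for f :: "'a \<Rightarrow> ennreal" and a
  proof -
    have "(\<integral>\<^sup>+x. f x \<partial>lborel) = (\<integral>\<^sup>+x. f x \<partial>density (distr lborel borel (\<lambda>x. a + (-1) *\<^sub>R x)) (\<lambda>_. 1))"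
      by (subst lborel_affine[of "-1" a]) (simp_all add: ennreal_power)
    also have "\<dots> = (\<integral>\<^sup>+x. f (a + (-1) *\<^sub>R x) \<partial>lborel)"
      by (subst density_1, intro nn_integral_distr) measurable
    finally show ?thesis by simp
  qed
  have "emeasure M A * emeasure lborel B = (\<integral>\<^sup>+x. indicator A x * emeasure lborel B \<partial>M)"
    by (subst nn_integral_multc) (simp_all add: sM)
  also have "\<dots> = (\<integral>\<^sup>+x. \<integral>\<^sup>+y. indicator A x * indicator B (x + y) \<partial>lborel \<partial>M)"
    by (intro nn_integral_cong) (simp add: nn_integral_cmult transL[of "indicator B"])
  also have "\<dots> = (\<integral>\<^sup>+y. \<integral>\<^sup>+x. indicator A x * indicator B (x + y) \<partial>M \<partial>lborel)"
    by (subst P.Fubini') simp_all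
  also have "\<dots> = (\<integral>\<^sup>+y. \<integral>\<^sup>+x. indicator A (x - y) * indicator B x \<partial>M \<partial>lborel)"
  proof (rule nn_integral_cong)
    fix y :: 'a
    show "(\<integral>\<^sup>+x. indicator A x * indicator B (x + y) \<partial>M) = (\<integral>\<^sup>+x. indicator A (x - y) * indicator B x \<partial>M)"
      using transM[of "\<lambda>x. indicator A (x - y) * indicator B x" y] by simp
  qed
  also have "\<dots> = (\<integral>\<^sup>+x. \<integral>\<^sup>+y. indicator A (x - y) * indicator B x \<partial>lborel \<partial>M)"
    by (subst P.Fubini') simp_all
  also have "\<dots> = (\<integral>\<^sup>+x. indicator B x * emeasure lborel A \<partial>M)"
  proof (rule nn_integral_cong)
    fix x
    have "(\<integral>\<^sup>+y. indicator A (x - y) * indicator B x \<partial>lborel)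
      = (\<integral>\<^sup>+y. indicator A (x - y) \<partial>lborel) * indicator B x"
      by (rule nn_integral_multc) measurable
    then show "(\<integral>\<^sup>+y. indicator A (x - y) * indicator B x \<partial>lborel) = indicator B x * emeasure lborel A"
      using reflL[of "indicator A" x] by (simp add: mult.commute)
  qed
  also have "\<dots> = emeasure M B * emeasure lborel A"
    by (simp add: nn_integral_multc sM)
  finally show ?thesis .
qed

text \<open>
  The image of Lebesgue measure under an injective linear map is translation invariant, hence
  proportional to Lebesgue measure. The factor is \<open>1 / \<bar>det F\<bar>\<close>; its value is left open
  because only its being positive and finite matters below.
\<close>

lemma nn_integral_linear_substitution:
  fixes F :: "'a::euclidean_space \<Rightarrow> 'a"
  assumes F: "linear F" "inj F"
  obtains c :: ennreal where "c \<noteq> 0" "c \<noteq> \<infinity>"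
    "\<And>f. f \<in> borel_measurable borel \<Longrightarrow> (\<integral>\<^sup>+x. f (F x) \<partial>lborel) = c * (\<integral>\<^sup>+x. f x \<partial>lborel)"
proof -
  have [measurable]: "F \<in> borel_measurable borel"
    using F(1) by (intro borel_measurable_continuous_onI) (simp add: linear_continuous_on linear_linear)
  obtain G where G: "linear G" "\<And>x. F (G x) = x" "\<And>x. G (F x) = x"
    using linear_injective_isomorphism[OF F] by blast
  define M where "M = distr lborel borel F"
  have sM: "sets M = sets borel" by (simp add: M_def)
  have em: "emeasure M A = emeasure lborel (F -` A)" if "A \<in> sets borel" for A
    using that unfolding M_def by (subst emeasure_distr) auto
  have comp: "compact (F -` cbox a b)" for a b
  proof -
    have "F -` cbox a b = G ` cbox a b"
      using G(2,3) by (auto intro!: image_eqI[where x="F _"])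
    then show ?thesis using G(1)
      by (simp add: compact_continuous_image linear_continuous_on linear_linear)
  qed
  have fin: "emeasure M (cbox a b) < \<infinity>" for a b
    using emeasure_compact_finite[OF comp[of a b]] by (simp add: em)
  have sf: "sigma_finite_measure M"
  proof
    show "\<exists>C. countable C \<and> C \<subseteq> sets M \<and> \<Union> C = space M \<and> (\<forall>a\<in>C. emeasure M a \<noteq> \<infinity>)"
    proof (intro exI conjI)
      show "countable (range (\<lambda>n. cbox (- real n *\<^sub>R One) (real n *\<^sub>R One :: 'a)))" by simp
      show "range (\<lambda>n. cbox (- real n *\<^sub>R One) (real n *\<^sub>R One :: 'a)) \<subseteq> sets M" by (auto simp: sM)
      have "\<exists>n. x \<in> cbox (- real n *\<^sub>R One) (real n *\<^sub>R One)" for x :: 'a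
      proof -
        obtain n where "norm x \<le> real n" using real_arch_simple by blast
        then show ?thesis using Basis_le_norm[of _ x]
          by (intro exI[of _ n]) (force simp: mem_box abs_le_iff)
      qed
      then show "\<Union> (range (\<lambda>n. cbox (- real n *\<^sub>R One) (real n *\<^sub>R One :: 'a))) = space M"
        by (auto simp: M_def)
      show "\<forall>a\<in>range (\<lambda>n. cbox (- real n *\<^sub>R One) (real n *\<^sub>R One :: 'a)). emeasure M a \<noteq> \<infinity>"
        using fin by (auto simp: less_top)
    qed
  qed
  have inv: "distr M borel (\<lambda>x. x + a) = M" for a
  proof -
    have "distr M borel (\<lambda>x. x + a) = distr lborel borel (\<lambda>x. F x + a)"
      unfolding M_def by (subst distr_distr) (auto simp: comp_def)
    also have "(\<lambda>x. F x + a) = F \<circ> (+) (G a)"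
      using G linear_add[OF F(1)] by (auto simp: fun_eq_iff add.commute)
    also have "distr lborel borel (F \<circ> (+) (G a)) = distr (distr lborel borel ((+) (G a))) borel F"
      by (subst distr_distr) auto
    also have "\<dots> = M" by (simp add: lborel_distr_plus M_def)
    finally show ?thesis .
  qed
  define c where "c = emeasure M (cbox 0 One)"
  have "emeasure M A = c * emeasure lborel A" if "A \<in> sets borel" for A
    using translation_invariant_measure_unique[OF sM sf inv that, of "cbox 0 One"]
    by (simp add: c_def emeasure_lborel_cbox)
  then have M: "M = density lborel (\<lambda>_. c)"
    by (intro measure_eqI) (auto simp: sM emeasure_density nn_integral_cmult)
  have "c \<noteq> \<infinity>" using fin[of 0 One] by (simp add: c_def)
  moreover have "c \<noteq> 0"
  proof
    assume "c = 0"
    then have "emeasure M UNIV = 0" by (simp add: M emeasure_density)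
    then show False by (simp add: em emeasure_lborel_UNIV)
  qed
  moreover have "(\<integral>\<^sup>+x. f (F x) \<partial>lborel) = c * (\<integral>\<^sup>+x. f x \<partial>lborel)"
    if [measurable]: "f \<in> borel_measurable borel" for f :: "'a \<Rightarrow> ennreal"
  proof -
    have "(\<integral>\<^sup>+x. f (F x) \<partial>lborel) = (\<integral>\<^sup>+x. f x \<partial>M)"
      unfolding M_def by (intro nn_integral_distr[symmetric]) measurable
    also have "\<dots> = c * (\<integral>\<^sup>+x. f x \<partial>lborel)"
      unfolding M by (simp add: nn_integral_density nn_integral_cmult)
    finally show ?thesis .
  qed
  ultimately show ?thesis using that by blast
qed

lemma nn_integral_std_normal:
  assumes [measurable]: "f \<in> borel_measurable borel"
  shows "(\<integral>\<^sup>+s. ennreal (exp (- s\<^sup>2 / 2)) * f s \<partial>lborel)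
    = ennreal (sqrt (2 * pi)) * (\<integral>\<^sup>+s. f s \<partial>std_normal_distribution)"
proof -
  have "ennreal (exp (- s\<^sup>2 / 2)) = ennreal (sqrt (2 * pi)) * ennreal (std_normal_density s)" for s
    unfolding std_normal_density_def by (simp flip: ennreal_mult)
  then show ?thesis by (simp add: nn_integral_density mult.assoc nn_integral_cmult)
qed

text \<open>
  The Gaussian weight is a product over the coordinates, so all but two of them integrate out
  to a constant.
\<close>

lemma gaussian_integral_two_coordinates:
  fixes a b :: "'a::euclidean_space"
  assumes ab: "a \<in> Basis" "b \<in> Basis" "a \<noteq> b"
  obtains K :: ennreal where "K \<noteq> 0" "K \<noteq> \<infinity>"
    "\<And>h. h \<in> borel_measurable (borel \<Otimes>\<^sub>M borel) \<Longrightarrow>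
      (\<integral>\<^sup>+x. ennreal (exp (- (x \<bullet> x) / 2)) * h (x \<bullet> a, x \<bullet> b) \<partial>lborel)
      = K * (\<integral>\<^sup>+s. \<integral>\<^sup>+t. h (s, t) \<partial>std_normal_distribution \<partial>std_normal_distribution)"
proof -
  define w :: "real \<Rightarrow> ennreal" where "w s = ennreal (exp (- s\<^sup>2 / 2))" for s
  have [measurable]: "w \<in> borel_measurable borel" unfolding w_def by measurable
  define R where "R = Basis - {a, b}"
  have R: "Basis = insert a (insert b R)" "finite R" "a \<notin> insert b R" "b \<notin> R"
    using ab by (auto simp: R_def)
  interpret product_sigma_finite "\<lambda>_::'a. lborel :: real measure" by standard
  interpret N: prob_space std_normal_distribution by (rule prob_space_normal_density) simp
  define c :: ennreal where "c = ennreal (sqrt (2 * pi))"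
  have c: "c \<noteq> 0" "c \<noteq> \<infinity>" by (auto simp: c_def)
  have wN: "(\<integral>\<^sup>+s. w s * f s \<partial>lborel) = c * (\<integral>\<^sup>+s. f s \<partial>std_normal_distribution)"
    if "f \<in> borel_measurable borel" for f :: "real \<Rightarrow> ennreal"
    using nn_integral_std_normal[OF that] by (simp add: w_def c_def)
  have w1: "(\<integral>\<^sup>+s. w s \<partial>lborel) = c"
    using wN[of "\<lambda>_. 1"] N.emeasure_space_1 by simp
  define K where "K = c ^ card R * c * c"
  have "K \<noteq> 0" "K \<noteq> \<infinity>" using c by (auto simp: K_def ennreal_mult_eq_top_iff power_eq_top_ennreal)
  moreover have "(\<integral>\<^sup>+x. ennreal (exp (- (x \<bullet> x) / 2)) * h (x \<bullet> a, x \<bullet> b) \<partial>lborel)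
      = K * (\<integral>\<^sup>+s. \<integral>\<^sup>+t. h (s, t) \<partial>std_normal_distribution \<partial>std_normal_distribution)"
    if [measurable]: "h \<in> borel_measurable (borel \<Otimes>\<^sub>M borel)" for h :: "real \<times> real \<Rightarrow> ennreal"
  proof -
    have e: "ennreal (exp (- (x \<bullet> x) / 2)) = (\<Prod>i\<in>Basis. w (x \<bullet> i))" for x :: 'a
    proof -
      have "exp (- (x \<bullet> x) / 2) = exp (\<Sum>i\<in>Basis. - (x \<bullet> i)\<^sup>2 / 2)"
        by (simp add: euclidean_inner[of x x] sum_negf sum_divide_distrib power2_eq_square)
      also have "\<dots> = (\<Prod>i\<in>Basis. exp (- (x \<bullet> i)\<^sup>2 / 2))" by (simp add: exp_sum)
      finally show ?thesis by (simp add: w_def prod_ennreal)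
    qed
    have "(\<integral>\<^sup>+x. ennreal (exp (- (x \<bullet> x) / 2)) * h (x \<bullet> a, x \<bullet> b) \<partial>lborel)
      = (\<integral>\<^sup>+x. (\<Prod>i\<in>Basis. w (x \<bullet> i)) * h (x \<bullet> a, x \<bullet> b) \<partial>lborel)" by (simp only: e)
    also have "\<dots> = (\<integral>\<^sup>+f. (\<Prod>i\<in>Basis. w (f i)) * h (f a, f b) \<partial>Pi\<^sub>M Basis (\<lambda>_. lborel))"
      by (subst lborel_eq, subst nn_integral_distr) (auto intro!: nn_integral_cong prod.cong simp: ab)
    also have "\<dots> = (\<integral>\<^sup>+f. w (f a) * w (f b) * (\<Prod>i\<in>R. w (f i)) * h (f a, f b)
        \<partial>Pi\<^sub>M (insert a (insert b R)) (\<lambda>_. lborel))"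
    proof -
      have "(\<Prod>i\<in>Basis. w (f i)) = w (f a) * w (f b) * (\<Prod>i\<in>R. w (f i))" for f
        using R(2-) by (subst R(1)) (simp add: mult.assoc)
      then show ?thesis by (simp only: R(1)[symmetric])
    qed
    also have "\<dots> = (\<integral>\<^sup>+s. \<integral>\<^sup>+f. w s * w (f b) * (\<Prod>i\<in>R. w (f i)) * h (s, f b)
        \<partial>Pi\<^sub>M (insert b R) (\<lambda>_. lborel) \<partial>lborel)"
      using R(2-) by (subst product_nn_integral_insert_rev)
        (auto intro!: nn_integral_cong prod.cong arg_cong2[where f="(*)"])
    also have "\<dots> = (\<integral>\<^sup>+s. \<integral>\<^sup>+t. \<integral>\<^sup>+f. w s * w t * (\<Prod>i\<in>R. w (f i)) * h (s, t)
        \<partial>Pi\<^sub>M R (\<lambda>_. lborel) \<partial>lborel \<partial>lborel)"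
      using R(2-) by (intro nn_integral_cong, subst product_nn_integral_insert_rev)
        (auto intro!: nn_integral_cong prod.cong arg_cong2[where f="(*)"])
    also have "\<dots> = (\<integral>\<^sup>+s. \<integral>\<^sup>+t. w s * w t * h (s, t) * c ^ card R \<partial>lborel \<partial>lborel)"
    proof (intro nn_integral_cong)
      fix s t :: real
      have "(\<integral>\<^sup>+f. w s * w t * (\<Prod>i\<in>R. w (f i)) * h (s, t) \<partial>Pi\<^sub>M R (\<lambda>_. lborel))
        = (\<integral>\<^sup>+f. w s * w t * h (s, t) * (\<Prod>i\<in>R. w (f i)) \<partial>Pi\<^sub>M R (\<lambda>_. lborel))"
        by (simp add: ac_simps)
      also have "\<dots> = w s * w t * h (s, t) * c ^ card R"
        using product_nn_integral_prod[OF R(2), of "\<lambda>_. w"]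
        by (subst nn_integral_cmult) (auto simp: w1)
      finally show "(\<integral>\<^sup>+f. w s * w t * (\<Prod>i\<in>R. w (f i)) * h (s, t) \<partial>Pi\<^sub>M R (\<lambda>_. lborel))
        = w s * w t * h (s, t) * c ^ card R" .
    qed
    also have "\<dots> = (\<integral>\<^sup>+s. w s * (c ^ card R * (\<integral>\<^sup>+t. w t * h (s, t) \<partial>lborel)) \<partial>lborel)"
    proof (intro nn_integral_cong)
      fix s :: real
      have "(\<integral>\<^sup>+t. w s * w t * h (s, t) * c ^ card R \<partial>lborel)
        = (\<integral>\<^sup>+t. (w s * c ^ card R) * (w t * h (s, t)) \<partial>lborel)" by (simp add: ac_simps)
      then show "(\<integral>\<^sup>+t. w s * w t * h (s, t) * c ^ card R \<partial>lborel)
        = w s * (c ^ card R * (\<integral>\<^sup>+t. w t * h (s, t) \<partial>lborel))"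
        by (simp add: nn_integral_cmult mult.assoc)
    qed
    also have "\<dots> = (\<integral>\<^sup>+s. w s * (c ^ card R * c * (\<integral>\<^sup>+t. h (s, t) \<partial>std_normal_distribution)) \<partial>lborel)"
      by (subst wN) (simp_all add: mult.assoc)
    also have "\<dots> = K * (\<integral>\<^sup>+s. \<integral>\<^sup>+t. h (s, t) \<partial>std_normal_distribution \<partial>std_normal_distribution)"
      by (subst wN) (simp_all add: K_def nn_integral_cmult ac_simps)
    finally show ?thesis .
  qed
  ultimately show ?thesis using that by blast
qed

section \<open>Two linear functionals of a multivariate normal vector\<close>

lemma pos_def_sym:
  assumes "pos_def_matrix S"
  shows "x \<bullet> (S *v y) = y \<bullet> (S *v x)"
  using assms unfolding pos_def_matrix_def
  by (metis dot_lmul_matrix inner_commute vector_transpose_matrix)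

text \<open>
  One Gram-Schmidt step for the inner product \<open>x \<bullet> (S *v y)\<close>.
\<close>

lemma orthonormal_step:
  assumes S: "pos_def_matrix S" and "finite K"
    and f: "\<And>i j. i \<in> K \<Longrightarrow> j \<in> K \<Longrightarrow> f i \<bullet> (S *v f j) = (if i = j then 1 else 0)"
    and z: "z \<notin> span (f ` K)"
  obtains r where "r \<bullet> (S *v r) = 1" "\<And>k. k \<in> K \<Longrightarrow> f k \<bullet> (S *v r) = 0"
proof -
  define w where "w = z - (\<Sum>k\<in>K. (f k \<bullet> (S *v z)) *\<^sub>R f k)"
  have "(\<Sum>k\<in>K. (f k \<bullet> (S *v z)) *\<^sub>R f k) \<in> span (f ` K)"
    by (intro span_sum span_scale span_base) auto
  then have "w \<noteq> 0" using z by (auto simp: w_def)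
  then have pos: "w \<bullet> (S *v w) > 0" using S by (simp add: pos_def_matrix_def)
  have orth: "f k \<bullet> (S *v w) = 0" if "k \<in> K" for k
  proof -
    have "f k \<bullet> (S *v w) = f k \<bullet> (S *v z) - (\<Sum>l\<in>K. (f l \<bullet> (S *v z)) * (f k \<bullet> (S *v f l)))"
      unfolding w_def
      by (simp add: matrix_vector_mult_diff_distrib inner_diff_right inner_sum_right
          linear_sum[OF matrix_vector_mul_linear] matrix_vector_mult_scaleR)
    also have "(\<Sum>l\<in>K. (f l \<bullet> (S *v z)) * (f k \<bullet> (S *v f l)))
        = (\<Sum>l\<in>K. if k = l then f l \<bullet> (S *v z) else 0)"
      using f that by (intro sum.cong) auto
    also have "\<dots> = f k \<bullet> (S *v z)" using that \<open>finite K\<close> by simp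
    finally show ?thesis by simp
  qed
  show ?thesis
  proof (rule that)
    show "(w /\<^sub>R sqrt (w \<bullet> (S *v w))) \<bullet> (S *v (w /\<^sub>R sqrt (w \<bullet> (S *v w)))) = 1"
      using pos by (simp add: matrix_vector_mult_scaleR field_simps)
    show "f k \<bullet> (S *v (w /\<^sub>R sqrt (w \<bullet> (S *v w)))) = 0" if "k \<in> K" for k
      using orth[OF that] by (simp add: matrix_vector_mult_scaleR)
  qed
qed

lemma orthonormal_extension:
  fixes S :: "real^'n^'n" and f :: "'n \<Rightarrow> real^'n"
  assumes S: "pos_def_matrix S"
    and f: "\<And>i j. i \<in> K \<Longrightarrow> j \<in> K \<Longrightarrow> f i \<bullet> (S *v f j) = (if i = j then 1 else 0)"
  shows "\<exists>g. (\<forall>i\<in>K. g i = f i) \<and> (\<forall>i j. g i \<bullet> (S *v g j) = (if i = j then 1 else 0))"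
proof -
  have "\<exists>g. (\<forall>i\<in>K. g i = f i) \<and>
    (\<forall>i\<in>K \<union> L. \<forall>j\<in>K \<union> L. g i \<bullet> (S *v g j) = (if i = j then 1 else 0))" for L
  proof (induction L rule: finite_induct[OF finite])
    case 1
    then show ?case using f by auto
  next
    case (2 a L)
    then obtain g where g: "\<And>i. i \<in> K \<Longrightarrow> g i = f i"
      "\<And>i j. i \<in> K \<union> L \<Longrightarrow> j \<in> K \<union> L \<Longrightarrow> g i \<bullet> (S *v g j) = (if i = j then 1 else 0)"
      by blast
    show ?case
    proof (cases "a \<in> K")
      case True
      then have "K \<union> insert a L = K \<union> L" by auto
      then show ?thesis using g by (intro exI[of _ g]) simp
    next
      case False
      then have a: "a \<notin> K \<union> L" using 2 by auto
      have "dim (g ` (K \<union> L)) \<le> card (g ` (K \<union> L))" by (rule dim_le_card') simp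
      also have "\<dots> \<le> card (K \<union> L)" by (rule card_image_le) simp
      also have "\<dots> < CARD('n)" using a by (intro psubset_card_mono) auto
      finally have "span (g ` (K \<union> L)) \<noteq> UNIV"
        using dim_eq_full[of "g ` (K \<union> L)"] by simp
      then obtain z where "z \<notin> span (g ` (K \<union> L))" by auto
      then obtain r where r: "r \<bullet> (S *v r) = 1" "\<And>k. k \<in> K \<union> L \<Longrightarrow> g k \<bullet> (S *v r) = 0"
        using orthonormal_step[OF S _ g(2)] by (metis finite)
      then have "r \<bullet> (S *v g k) = 0" if "k \<in> K \<union> L" for k
        using that pos_def_sym[OF S] by metis
      then show ?thesis using g r False a
        by (intro exI[of _ "g(a := r)"]) auto
    qed
  qed
  from this[of UNIV] show ?thesis by simp
qed

text \<open>
  Gram-Schmidt applied to \<open>u, v\<close>, with arbitrary completion where \<open>u\<close> or the remainder of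
  \<open>v\<close> vanishes. The index type must have two elements to hold the two basis vectors.
\<close>

lemma orthonormal_pair_spanning:
  fixes S :: "real^'n^'n" and k1 k2 :: 'n
  assumes S: "pos_def_matrix S" and k: "k1 \<noteq> k2"
  obtains f \<alpha> \<beta> \<gamma> where "\<And>i j. f i \<bullet> (S *v f j) = (if i = j then 1 else 0)"
    "u = \<alpha> *\<^sub>R f k1" "v = \<beta> *\<^sub>R f k1 + \<gamma> *\<^sub>R f k2"
proof -
  have unit: "(x /\<^sub>R sqrt (x \<bullet> (S *v x))) \<bullet> (S *v (x /\<^sub>R sqrt (x \<bullet> (S *v x)))) = 1"
    "sqrt (x \<bullet> (S *v x)) *\<^sub>R (x /\<^sub>R sqrt (x \<bullet> (S *v x))) = x" if "x \<noteq> 0" for x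
  proof -
    have "x \<bullet> (S *v x) > 0" using S that by (simp add: pos_def_matrix_def)
    then show "(x /\<^sub>R sqrt (x \<bullet> (S *v x))) \<bullet> (S *v (x /\<^sub>R sqrt (x \<bullet> (S *v x)))) = 1"
      by (simp add: matrix_vector_mult_scaleR field_simps)
    show "sqrt (x \<bullet> (S *v x)) *\<^sub>R (x /\<^sub>R sqrt (x \<bullet> (S *v x))) = x"
      using \<open>x \<bullet> (S *v x) > 0\<close> by simp
  qed
  have "\<exists>e \<alpha>. e \<bullet> (S *v e) = 1 \<and> u = \<alpha> *\<^sub>R e"
  proof (cases "u = 0")
    case True
    obtain g where "\<forall>i j :: 'n. g i \<bullet> (S *v g j) = (if i = j then 1 else 0)"
      using orthonormal_extension[OF S, of "{}"] by blast
    then show ?thesis using True by (intro exI[of _ "g k1"] exI[of _ 0]) simp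
  next
    case False
    show ?thesis
      using unit[OF False]
      by (intro exI[of _ "u /\<^sub>R sqrt (u \<bullet> (S *v u))"] exI[of _ "sqrt (u \<bullet> (S *v u))"]) (simp only: simp_thms)
  qed
  then obtain e \<alpha> where e: "e \<bullet> (S *v e) = 1" "u = \<alpha> *\<^sub>R e" by blast
  have ev: "e \<bullet> (S *v v) = v \<bullet> (S *v e)" by (rule pos_def_sym[OF S])
  define r where "r = v - (e \<bullet> (S *v v)) *\<^sub>R e"
  have er: "e \<bullet> (S *v r) = 0" "r \<bullet> (S *v e) = 0"
    unfolding r_def using e(1)
    by (simp_all add: matrix_vector_mult_diff_distrib inner_diff matrix_vector_mult_scaleR ev)
  show ?thesis
  proof (cases "r = 0")
    case True
    have "\<exists>g. (\<forall>i\<in>{k1}. g i = e) \<and> (\<forall>i j. g i \<bullet> (S *v g j) = (if i = j then 1 else 0))"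
      by (rule orthonormal_extension[OF S]) (simp add: e(1))
    then obtain g where g: "g k1 = e" "\<And>i j. g i \<bullet> (S *v g j) = (if i = j then 1 else 0)"
      by blast
    show ?thesis
    proof (rule that)
      show "u = \<alpha> *\<^sub>R g k1" by (simp only: g e)
      show "v = (e \<bullet> (S *v v)) *\<^sub>R g k1 + 0 *\<^sub>R g k2"
        using True by (simp add: g r_def)
      show "g i \<bullet> (S *v g j) = (if i = j then 1 else 0)" for i j by (rule g(2))
    qed
  next
    case False
    define f where "f = (\<lambda>_. r /\<^sub>R sqrt (r \<bullet> (S *v r)))(k1 := e)"
    have f12: "f k1 = e" "f k2 = r /\<^sub>R sqrt (r \<bullet> (S *v r))" using k by (auto simp: f_def)
    have "f k1 \<bullet> (S *v f k1) = 1" "f k2 \<bullet> (S *v f k2) = 1" "f k1 \<bullet> (S *v f k2) = 0" "f k2 \<bullet> (S *v f k1) = 0"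
      unfolding f12 by (fact e(1), fact unit(1)[OF False], simp_all add: er matrix_vector_mult_scaleR)
    then have "\<exists>g. (\<forall>i\<in>{k1, k2}. g i = f i) \<and> (\<forall>i j. g i \<bullet> (S *v g j) = (if i = j then 1 else 0))"
      using k by (intro orthonormal_extension[OF S]) auto
    then obtain g where g: "\<And>i. i \<in> {k1, k2} \<Longrightarrow> g i = f i"
      "\<And>i j. g i \<bullet> (S *v g j) = (if i = j then 1 else 0)"
      by blast
    have "g k1 = e" "g k2 = r /\<^sub>R sqrt (r \<bullet> (S *v r))" using g(1) f12 by simp_all
    note gk = this
    have v: "v = (e \<bullet> (S *v v)) *\<^sub>R e + r" by (simp add: r_def)
    show ?thesis
    proof (rule that)
      show "u = \<alpha> *\<^sub>R g k1" by (simp only: gk e)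
      show "v = (e \<bullet> (S *v v)) *\<^sub>R g k1 + sqrt (r \<bullet> (S *v r)) *\<^sub>R g k2"
        unfolding gk unit(2)[OF False] by (rule v)
      show "g i \<bullet> (S *v g j) = (if i = j then 1 else 0)" for i j by (rule g(2))
    qed
  qed
qed

text \<open>
  The rows of \<open>F\<close> being orthonormal means \<open>F S F\<^sup>T = 1\<close>, so \<open>S\<inverse> = F\<^sup>T F\<close>: the
  coordinates \<open>F x\<close> of a vector with covariance \<open>S\<close> are independent and standard normal.
  The sign of \<open>det S\<close> comes out of the same factorisation.
\<close>

lemma whitening_matrix:
  fixes S :: "real^'n^'n" and f :: "'n \<Rightarrow> real^'n"
  assumes f: "\<And>i j. f i \<bullet> (S *v f j) = (if i = j then 1 else 0)"
  defines "F \<equiv> (\<chi> i. f i)"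
  shows "inj ((*v) F)" "det S > 0" "x \<bullet> (matrix_inv S *v x) = (F *v x) \<bullet> (F *v x)"
proof -
  have "(F ** (S ** transpose F)) $ i $ j = f i \<bullet> (S *v f j)" for i j
    by (simp add: matrix_matrix_mult_def matrix_vector_mult_def inner_vec_def transpose_def F_def)
  then have FSF: "F ** (S ** transpose F) = mat 1" using f by (simp add: vec_eq_iff mat_def)
  have FtF: "transpose F ** F ** S = mat 1"
    using FSF matrix_left_right_inverse by (metis matrix_mul_assoc)
  have SFt: "S ** (transpose F ** F) = mat 1"
    using FSF matrix_left_right_inverse by (metis matrix_mul_assoc)
  have inv: "matrix_inv S = transpose F ** F"
    unfolding matrix_inv_def
  proof (rule some_equality)
    fix B assume "S ** B = mat 1 \<and> B ** S = mat 1"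
    then show "B = transpose F ** F" using FtF by (metis matrix_mul_assoc matrix_mul_lid matrix_mul_rid)
  qed (use SFt FtF in simp)
  have dF: "det F * (det S * det F) = 1" using arg_cong[OF FSF, of det] by (simp add: det_mul det_transpose)
  then have "invertible F" by (auto simp: invertible_det_nz)
  then show "inj ((*v) F)" by (rule inj_matrix_vector_mult)
  have "det S * (det F)\<^sup>2 = 1" using dF by (simp add: power2_eq_square algebra_simps)
  then show "det S > 0" by (smt (verit) mult_nonpos_nonneg zero_le_power2)
  show "x \<bullet> (matrix_inv S *v x) = (F *v x) \<bullet> (F *v x)"
  proof -
    have "(F *v x) \<bullet> (F *v x) = ((F *v x) v* F) \<bullet> x" by (rule dot_lmul_matrix[symmetric])
    also have "\<dots> = x \<bullet> (transpose F *v (F *v x))" by (simp add: inner_commute)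
    finally show ?thesis unfolding inv by (simp only: matrix_vector_mul_assoc)
  qed
qed

text \<open>
  The pair \<open>(u \<bullet> x, v \<bullet> x)\<close> is distributed as
  \<open>(\<alpha> s, \<beta> s + \<gamma> t)\<close> with independent standard normal \<open>s, t\<close>, a Cholesky
  factorisation of its covariance matrix. The total mass is kept as a factor; it equals 1, but
  evaluating it would require the Jacobian of the whitening map.
\<close>

lemma mvn_pair_integral:
  fixes S :: "real^'n^'n" and k1 k2 :: 'n
  assumes S: "pos_def_matrix S" and k: "k1 \<noteq> k2"
  obtains \<alpha> \<beta> \<gamma> where "u \<bullet> (S *v u) = \<alpha>\<^sup>2" "u \<bullet> (S *v v) = \<alpha> * \<beta>" "v \<bullet> (S *v v) = \<beta>\<^sup>2 + \<gamma>\<^sup>2"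
    "emeasure (mvn S) UNIV \<noteq> 0" "emeasure (mvn S) UNIV \<noteq> \<infinity>"
    "\<And>h. h \<in> borel_measurable (borel \<Otimes>\<^sub>M borel) \<Longrightarrow> (\<integral>\<^sup>+x. h (u \<bullet> x, v \<bullet> x) \<partial>mvn S)
      = emeasure (mvn S) UNIV *
        (\<integral>\<^sup>+s. \<integral>\<^sup>+t. h (\<alpha> * s, \<beta> * s + \<gamma> * t) \<partial>std_normal_distribution \<partial>std_normal_distribution)"
proof -
  obtain f \<alpha> \<beta> \<gamma> where f: "\<And>i j. f i \<bullet> (S *v f j) = (if i = j then 1 else 0)"
    and uv: "u = \<alpha> *\<^sub>R f k1" "v = \<beta> *\<^sub>R f k1 + \<gamma> *\<^sub>R f k2"
    using orthonormal_pair_spanning[OF S k, of u v] by blast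
  have cov: "u \<bullet> (S *v u) = \<alpha>\<^sup>2" "u \<bullet> (S *v v) = \<alpha> * \<beta>" "v \<bullet> (S *v v) = \<beta>\<^sup>2 + \<gamma>\<^sup>2"
    using k by (simp_all add: uv f matrix_vector_right_distrib matrix_vector_mult_scaleR
        inner_add_left inner_add_right power2_eq_square)
  define F where "F = (\<chi> i. f i)"
  note W = whitening_matrix[of f S, OF f, folded F_def]
  obtain c :: ennreal where c: "c \<noteq> 0" "c \<noteq> \<infinity>"
    "\<And>g. g \<in> borel_measurable borel \<Longrightarrow> (\<integral>\<^sup>+x. g (F *v x) \<partial>lborel) = c * (\<integral>\<^sup>+x. g x \<partial>lborel)"
    using nn_integral_linear_substitution[OF matrix_vector_mul_linear W(1)] by blast
  have "axis k1 1 \<in> (Basis :: (real^'n) set)" "axis k2 1 \<in> (Basis :: (real^'n) set)"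
    "axis k1 (1::real) \<noteq> axis k2 1" using k by (auto simp: axis_in_Basis_iff axis_eq_axis)
  then obtain K :: ennreal where K: "K \<noteq> 0" "K \<noteq> \<infinity>"
    "\<And>h. h \<in> borel_measurable (borel \<Otimes>\<^sub>M borel) \<Longrightarrow>
      (\<integral>\<^sup>+x. ennreal (exp (- (x \<bullet> x) / 2)) * h (x \<bullet> axis k1 1, x \<bullet> axis k2 1) \<partial>(lborel :: (real^'n) measure))
      = K * (\<integral>\<^sup>+s. \<integral>\<^sup>+t. h (s, t) \<partial>std_normal_distribution \<partial>std_normal_distribution)"
    using gaussian_integral_two_coordinates by blast
  define C where "C = 1 / sqrt ((2 * pi) ^ CARD('n) * det S)"
  have C: "C > 0" using W(2) by (simp add: C_def)
  define m where "m = ennreal C * c * K"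
  have dens: "ennreal (mvn_density S x) = ennreal C * ennreal (exp (- ((F *v x) \<bullet> (F *v x)) / 2))" for x
    using C by (simp add: mvn_density_def W(3) C_def flip: ennreal_mult)
  have meas_F[measurable]: "(*v) F \<in> borel_measurable borel"
    by (intro borel_measurable_continuous_onI) (simp add: linear_continuous_on linear_linear)
  have main: "(\<integral>\<^sup>+x. h (u \<bullet> x, v \<bullet> x) \<partial>mvn S)
      = m * (\<integral>\<^sup>+s. \<integral>\<^sup>+t. h (\<alpha> * s, \<beta> * s + \<gamma> * t) \<partial>std_normal_distribution \<partial>std_normal_distribution)"
    if [measurable]: "h \<in> borel_measurable (borel \<Otimes>\<^sub>M borel)" for h :: "real \<times> real \<Rightarrow> ennreal"
  proof -
    define h' where "h' = (\<lambda>(s, t). h (\<alpha> * s, \<beta> * s + \<gamma> * t))"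
    have [measurable]: "h' \<in> borel_measurable (borel \<Otimes>\<^sub>M borel)" unfolding h'_def by measurable
    have coord: "u \<bullet> x = \<alpha> * ((F *v x) \<bullet> axis k1 1)"
      "v \<bullet> x = \<beta> * ((F *v x) \<bullet> axis k1 1) + \<gamma> * ((F *v x) \<bullet> axis k2 1)" for x
      by (simp_all add: uv F_def inner_axis matrix_vector_mul_component inner_add_left)
    have [measurable]: "mvn_density S \<in> borel_measurable borel"
    proof -
      have "mvn_density S = (\<lambda>x. C * exp (- ((F *v x) \<bullet> (F *v x)) / 2))"
        by (simp add: mvn_density_def W(3) C_def fun_eq_iff)
      then show ?thesis by simp
    qed
    have "(\<integral>\<^sup>+x. h (u \<bullet> x, v \<bullet> x) \<partial>mvn S)
      = (\<integral>\<^sup>+x. ennreal (mvn_density S x) * h (u \<bullet> x, v \<bullet> x) \<partial>lborel)"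
      unfolding mvn_def by (subst nn_integral_density) auto
    also have "\<dots> = (\<integral>\<^sup>+x. ennreal C * (\<lambda>y :: real^'n. ennreal (exp (- (y \<bullet> y) / 2)) *
        h' (y \<bullet> axis k1 1, y \<bullet> axis k2 1)) (F *v x) \<partial>lborel)"
      by (simp only: dens coord h'_def prod.case mult.assoc)
    also have "\<dots> = ennreal C * (\<integral>\<^sup>+x. (\<lambda>y :: real^'n. ennreal (exp (- (y \<bullet> y) / 2)) *
        h' (y \<bullet> axis k1 1, y \<bullet> axis k2 1)) (F *v x) \<partial>lborel)"
      by (rule nn_integral_cmult) measurable
    also have "\<dots> = ennreal C * (c * (\<integral>\<^sup>+y. ennreal (exp (- (y \<bullet> y) / 2)) *
        h' (y \<bullet> axis k1 1, y \<bullet> axis k2 1) \<partial>(lborel :: (real^'n) measure)))"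
      by (subst c(3)) simp_all
    also have "\<dots> = m * (\<integral>\<^sup>+s. \<integral>\<^sup>+t. h' (s, t) \<partial>std_normal_distribution \<partial>std_normal_distribution)"
      by (subst K(3)) (simp_all add: m_def mult.assoc)
    finally show ?thesis by (simp add: h'_def)
  qed
  interpret N: prob_space std_normal_distribution by (rule prob_space_normal_density) simp
  have m: "emeasure (mvn S) UNIV = m"
    using main[of "\<lambda>_. 1"] N.emeasure_space_1 by (simp add: mvn_def)
  have "m \<noteq> 0" "m \<noteq> \<infinity>" using c(1,2) K(1,2) C by (auto simp: m_def ennreal_mult_eq_top_iff)
  then show ?thesis using that[OF cov] main unfolding m by blast
qed

section \<open>Probit mixtures and normal orthant probabilities\<close>

abbreviation N where "N \<equiv> std_normal_distribution"
abbreviation Phi where "Phi \<equiv> std_normal_cdf"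

interpretation N: prob_space std_normal_distribution
  by (rule prob_space_normal_density) simp

lemma ennreal_Phi: "ennreal (Phi x) = (\<integral>\<^sup>+e. ennreal (std_normal_density e) * indicator {..x} e \<partial>lborel)"
  unfolding std_normal_cdf_def cdf_def
  by (simp add: N.emeasure_eq_measure[symmetric] emeasure_density)

text \<open>
  The standard normal density is positive, so a property that holds almost everywhere holds
  somewhere in every nonempty open interval. This turns pointwise strict inequalities into strict
  inequalities of integrals.
\<close>

lemma AE_N_interval:
  assumes "AE w in N. P w" "a < b"
  shows "\<exists>w. a < w \<and> w < b \<and> P w"
proof (rule ccontr)
  assume no: "\<not> ?thesis"
  have "AE w in lborel. P w"
    using assms(1) by (simp add: AE_density normal_density_pos)
  then have "AE w in lborel. w \<notin> {a<..<b}" by eventually_elim (use no in auto)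
  then have "emeasure lborel {a<..<b} = 0" by (subst (asm) AE_iff_null_sets[symmetric]) auto
  then show False using assms(2) by simp
qed

lemma Phi_less: "a < b \<Longrightarrow> Phi a < Phi b"
proof (rule ccontr)
  assume ab: "a < b" "\<not> Phi a < Phi b"
  have eq: "Phi b - Phi a = measure N {a<..b}"
    unfolding std_normal_cdf_def
    using finite_borel_measure.cdf_diff_eq[of N a b] ab real_dist_normal_dist
    by (simp add: real_distribution.finite_borel_measure_M)
  then have "measure N {a<..b} = 0" using ab measure_nonneg[of N "{a<..b}"] by linarith
  then have "AE w in N. w \<notin> {a<..b}"
    by (intro AE_not_in) (auto simp: null_sets_def N.emeasure_eq_measure)
  from AE_N_interval[OF this ab(1)] show False by auto
qed

lemma Phi_strict_mono: "strict_mono Phi" by (simp add: strict_mono_def Phi_less)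

lemma Phi_inject [simp]: "Phi a = Phi b \<longleftrightarrow> a = b"
  using strict_mono_eq[OF Phi_strict_mono] .

lemma Phi_bounds: "0 \<le> Phi x" "Phi x \<le> 1"
  by (simp_all add: std_normal_cdf_def cdf_def)

lemma borel_measurable_Phi [measurable]: "Phi \<in> borel_measurable borel"
  by (intro borel_measurable_mono strict_mono_mono Phi_strict_mono)

text \<open>
  Let \<open>e, z\<close> be independent standard normal. The event \<open>e \<le> d + \<alpha> z\<close> becomes
  \<open>w \<le> d / v\<close> for the rotated coordinates \<open>w = (e - \<alpha> z) / v\<close>,
  \<open>y = (\<alpha> e + z) / v\<close>, which are again independent standard normal, and
  \<open>z = (y - \<alpha> w) / v\<close>.
\<close>

lemma rotation_integral:
  fixes \<alpha> d :: real
  assumes [measurable]: "g \<in> borel_measurable borel"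
  defines "v \<equiv> sqrt (1 + \<alpha>\<^sup>2)"
  shows "(\<integral>\<^sup>+z. ennreal (Phi (d + \<alpha> * z)) * g z \<partial>N)
    = (\<integral>\<^sup>+w. indicator {..d / v} w * (\<integral>\<^sup>+y. g ((y - \<alpha> * w) / v) \<partial>N) \<partial>N)"
proof -
  have v: "v > 0" "v\<^sup>2 = 1 + \<alpha>\<^sup>2" by (auto simp: v_def add_pos_nonneg)
  let ?\<phi> = "\<lambda>x. ennreal (std_normal_density x)"
  have "(\<integral>\<^sup>+z. ennreal (Phi (d + \<alpha> * z)) * g z \<partial>N)
    = (\<integral>\<^sup>+z. \<integral>\<^sup>+w. ennreal v * (?\<phi> (\<alpha> * z + v * w) * ?\<phi> z) * indicator {..d / v} w * g z \<partial>lborel \<partial>lborel)"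
  proof (subst nn_integral_density, simp, simp, rule nn_integral_cong)
    fix z
    have "ennreal (Phi (d + \<alpha> * z)) = ennreal v * (\<integral>\<^sup>+w. ?\<phi> (\<alpha> * z + v * w) * indicator {..d + \<alpha> * z} (\<alpha> * z + v * w) \<partial>lborel)"
      unfolding ennreal_Phi using v(1)
      by (subst nn_integral_real_affine[where c=v and t="\<alpha> * z"]) auto
    also have "\<dots> = ennreal v * (\<integral>\<^sup>+w. ?\<phi> (\<alpha> * z + v * w) * indicator {..d / v} w \<partial>lborel)"
      using v(1) by (intro arg_cong2[where f="(*)"] nn_integral_cong refl)
        (auto simp: indicator_def field_simps)
    finally have "?\<phi> z * (ennreal (Phi (d + \<alpha> * z)) * g z)
      = (ennreal v * ?\<phi> z * g z) * (\<integral>\<^sup>+w. ?\<phi> (\<alpha> * z + v * w) * indicator {..d / v} w \<partial>lborel)"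
      by (simp add: ac_simps)
    also have "\<dots> = (\<integral>\<^sup>+w. (ennreal v * ?\<phi> z * g z) * (?\<phi> (\<alpha> * z + v * w) * indicator {..d / v} w) \<partial>lborel)"
      by (rule nn_integral_cmult[symmetric]) measurable
    finally show "?\<phi> z * (ennreal (Phi (d + \<alpha> * z)) * g z)
      = (\<integral>\<^sup>+w. ennreal v * (?\<phi> (\<alpha> * z + v * w) * ?\<phi> z) * indicator {..d / v} w * g z \<partial>lborel)"
      by (simp add: ac_simps)
  qed
  also have "\<dots> = (\<integral>\<^sup>+w. \<integral>\<^sup>+z. ennreal v * (?\<phi> (\<alpha> * z + v * w) * ?\<phi> z) * indicator {..d / v} w * g z \<partial>lborel \<partial>lborel)"
    by (rule lborel_pair.Fubini'[symmetric]) simp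
  also have "\<dots> = (\<integral>\<^sup>+w. ?\<phi> w * (indicator {..d / v} w * (\<integral>\<^sup>+y. g ((y - \<alpha> * w) / v) \<partial>N)) \<partial>lborel)"
  proof (rule nn_integral_cong)
    fix w :: real
    \<comment> \<open>Rotation invariance of the planar standard normal density.\<close>
    have rot: "?\<phi> (\<alpha> * ((y - \<alpha> * w) / v) + v * w) * ?\<phi> ((y - \<alpha> * w) / v) = ?\<phi> w * ?\<phi> y" for y
    proof -
      have 1: "\<alpha> * ((y - \<alpha> * w) / v) + v * w = (w + \<alpha> * y) / v"
      proof -
        have "v * (v * w) = w + \<alpha> * (\<alpha> * w)"
        proof -
          have "v * (v * w) = v\<^sup>2 * w" by (simp add: power2_eq_square)
          then show ?thesis unfolding v(2) by (simp add: power2_eq_square algebra_simps)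
        qed
        then show ?thesis using v(1) by (simp add: field_simps)
      qed
      have "((w + \<alpha> * y) / v)\<^sup>2 + ((y - \<alpha> * w) / v)\<^sup>2 = ((w + \<alpha> * y)\<^sup>2 + (y - \<alpha> * w)\<^sup>2) / v\<^sup>2"
        by (simp only: power_divide add_divide_distrib[symmetric])
      also have "(w + \<alpha> * y)\<^sup>2 + (y - \<alpha> * w)\<^sup>2 = (w\<^sup>2 + y\<^sup>2) * v\<^sup>2"
        unfolding v(2) by (simp add: power2_eq_square algebra_simps)
      finally have "((w + \<alpha> * y) / v)\<^sup>2 + ((y - \<alpha> * w) / v)\<^sup>2 = w\<^sup>2 + y\<^sup>2" using v(1) by simp
      then have "exp (- ((w + \<alpha> * y) / v)\<^sup>2 / 2) * exp (- ((y - \<alpha> * w) / v)\<^sup>2 / 2)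
        = exp (- w\<^sup>2 / 2) * exp (- y\<^sup>2 / 2)"
        by (simp flip: exp_add add: field_simps)
      then show ?thesis unfolding 1 std_normal_density_def
        by (simp flip: ennreal_mult add: field_simps)
    qed
    have "(\<integral>\<^sup>+z. ennreal v * (?\<phi> (\<alpha> * z + v * w) * ?\<phi> z) * indicator {..d / v} w * g z \<partial>lborel)
      = ennreal (1 / v) * (\<integral>\<^sup>+y. ennreal v * (?\<phi> (\<alpha> * ((y - \<alpha> * w) / v) + v * w) * ?\<phi> ((y - \<alpha> * w) / v))
          * indicator {..d / v} w * g ((y - \<alpha> * w) / v) \<partial>lborel)"
      using v(1) by (subst nn_integral_real_affine[where c="1 / v" and t="- (\<alpha> * w) / v"])
        (auto simp: diff_divide_distrib)
    also have "\<dots> = ennreal (1 / v) * (\<integral>\<^sup>+y. (ennreal v * ?\<phi> w * indicator {..d / v} w) * (?\<phi> y * g ((y - \<alpha> * w) / v)) \<partial>lborel)"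
      unfolding rot by (simp add: ac_simps)
    also have "\<dots> = ennreal (1 / v) * (ennreal v * ?\<phi> w * indicator {..d / v} w) * (\<integral>\<^sup>+y. ?\<phi> y * g ((y - \<alpha> * w) / v) \<partial>lborel)"
      by (subst nn_integral_cmult) (auto simp: mult.assoc)
    also have "\<dots> = (ennreal (1 / v) * ennreal v) * (?\<phi> w * (indicator {..d / v} w * (\<integral>\<^sup>+y. g ((y - \<alpha> * w) / v) \<partial>N)))"
      by (subst nn_integral_density) (auto simp: ac_simps)
    also have "ennreal (1 / v) * ennreal v = 1" using v(1) by (simp flip: ennreal_mult)
    finally show "(\<integral>\<^sup>+z. ennreal v * (?\<phi> (\<alpha> * z + v * w) * ?\<phi> z) * indicator {..d / v} w * g z \<partial>lborel)
      = ?\<phi> w * (indicator {..d / v} w * (\<integral>\<^sup>+y. g ((y - \<alpha> * w) / v) \<partial>N))" by simp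
  qed
  also have "\<dots> = (\<integral>\<^sup>+w. indicator {..d / v} w * (\<integral>\<^sup>+y. g ((y - \<alpha> * w) / v) \<partial>N) \<partial>N)"
    by (subst nn_integral_density) auto
  finally show ?thesis .
qed

lemma emeasure_N_Iic: "emeasure N {..x} = ennreal (Phi x)"
  by (simp add: std_normal_cdf_def cdf_def N.emeasure_eq_measure)

lemma Phi_mixture: "(\<integral>\<^sup>+z. ennreal (Phi (d + \<alpha> * z)) \<partial>N) = ennreal (Phi (d / sqrt (1 + \<alpha>\<^sup>2)))"
  using rotation_integral[of "\<lambda>_. 1" d \<alpha>] N.emeasure_space_1 by (simp add: emeasure_N_Iic)

text \<open>
  The probability that \<open>X \<le> a\<close> and \<open>Y \<le> b\<close> for standard normal \<open>X, Y\<close> with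
  correlation \<open>r\<close>, obtained by conditioning on \<open>X = w\<close>.
\<close>

definition orthant :: "real \<Rightarrow> real \<Rightarrow> real \<Rightarrow> ennreal" where
  "orthant a b r = (\<integral>\<^sup>+w. indicator {..a} w * ennreal (Phi ((b - r * w) / sqrt (1 - r\<^sup>2))) \<partial>N)"

text \<open>
  As functions of \<open>w\<close>, the conditional probabilities of \<open>Y \<le> b\<close> for the two
  correlations are \<open>Phi\<close> of two lines whose slopes differ, so they cross exactly once, at a
  point \<open>c\<close>. If \<open>a \<le> c\<close> the two integrands are strictly ordered on
  \<open>w \<le> a\<close>. Otherwise they are strictly ordered on \<open>w > a\<close>, and the total integrals
  agree because both are the marginal probability of \<open>Y \<le> b\<close>.
\<close>

lemma orthant_neq_if_less:
  assumes rs: "r < s" "r\<^sup>2 < 1" "s\<^sup>2 < 1"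
  shows "orthant a b r \<noteq> orthant a b s"
proof
  assume eq: "orthant a b r = orthant a b s"
  define f where "f r w = Phi ((b - r * w) / sqrt (1 - r\<^sup>2))" for r w
  have [measurable]: "f r \<in> borel_measurable borel" for r unfolding f_def by measurable
  have total: "(\<integral>\<^sup>+w. ennreal (f r w) \<partial>N) = ennreal (Phi b)" if "r\<^sup>2 < 1" for r
  proof -
    have p: "sqrt (1 - r\<^sup>2) > 0" using that by simp
    have "1 + (- r / sqrt (1 - r\<^sup>2))\<^sup>2 = 1 / (1 - r\<^sup>2)"
      using that by (simp add: power_divide field_simps)
    then have "b / sqrt (1 - r\<^sup>2) / sqrt (1 + (- r / sqrt (1 - r\<^sup>2))\<^sup>2) = b"
      using p by (simp add: real_sqrt_divide)
    moreover have "f r w = Phi (b / sqrt (1 - r\<^sup>2) + (- r / sqrt (1 - r\<^sup>2)) * w)" for w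
      by (simp add: f_def diff_divide_distrib)
    ultimately show ?thesis
      using Phi_mixture[of "b / sqrt (1 - r\<^sup>2)" "- r / sqrt (1 - r\<^sup>2)"] by simp
  qed
  define B where "B = s / sqrt (1 - s\<^sup>2) - r / sqrt (1 - r\<^sup>2)"
  define A where "A = b / sqrt (1 - r\<^sup>2) - b / sqrt (1 - s\<^sup>2)"
  have diff: "(b - r * w) / sqrt (1 - r\<^sup>2) - (b - s * w) / sqrt (1 - s\<^sup>2) = A + B * w" for w
    by (simp add: A_def B_def diff_divide_distrib algebra_simps)
  have B: "B > 0"
  proof -
    define p q where pq: "p = sqrt (1 - r\<^sup>2)" "q = sqrt (1 - s\<^sup>2)"
    have pos: "p > 0" "q > 0" using rs by (auto simp: pq)
    consider "0 \<le> r" | "s \<le> 0" | "r < 0" "0 < s" by linarith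
    then have "r * q < s * p"
    proof cases
      case 1
      then have "q \<le> p" using rs power_mono[of r s 2] by (simp add: pq)
      then have "r * q \<le> r * p" using 1 by (intro mult_left_mono)
      also have "\<dots> < s * p" using rs pos by simp
      finally show ?thesis .
    next
      case 2
      then have "p \<le> q" using rs power_mono[of "- s" "- r" 2] by (simp add: pq)
      have "r * q < s * q" using rs pos by simp
      also have "\<dots> \<le> s * p" using 2 \<open>p \<le> q\<close> by (intro mult_left_mono_neg)
      finally show ?thesis .
    next
      case 3
      then have "r * q < 0" "0 < s * p" using pos by (auto simp: mult_neg_pos)
      then show ?thesis by linarith
    qed
    then show ?thesis using pos unfolding B_def pq[symmetric] by (simp add: field_simps)
  qed
  \<comment> \<open>The crossing point of the two lines.\<close>
  define c where "c = - A / B"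
  have below: "f r w < f s w" if "w < c" for w
    using diff[of w] that B by (auto simp: f_def c_def field_simps intro!: Phi_less)
  have above: "f s w < f r w" if "w > c" for w
    using diff[of w] that B by (auto simp: f_def c_def field_simps intro!: Phi_less)
  have bound: "(\<integral>\<^sup>+w. indicator C w * ennreal (f r w) \<partial>N) \<noteq> \<infinity>" if "r\<^sup>2 < 1" for C r
  proof -
    have "(\<integral>\<^sup>+w. indicator C w * ennreal (f r w) \<partial>N) \<le> (\<integral>\<^sup>+w. ennreal (f r w) \<partial>N)"
      by (intro nn_integral_mono) (auto simp: indicator_def)
    then show ?thesis using total[OF that] by (auto simp: top_unique)
  qed
  have eq': "(\<integral>\<^sup>+w. indicator {..a} w * ennreal (f r w) \<partial>N) = (\<integral>\<^sup>+w. indicator {..a} w * ennreal (f s w) \<partial>N)"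
    using eq by (simp add: orthant_def f_def)
  have pos: "0 \<le> f r w" for r w by (simp add: f_def Phi_bounds)
  show False
  proof (cases "a \<le> c")
    case True
    have "(\<integral>\<^sup>+w. indicator {..a} w * ennreal (f r w) \<partial>N) < (\<integral>\<^sup>+w. indicator {..a} w * ennreal (f s w) \<partial>N)"
    proof (rule nn_integral_less)
      have "f r w \<le> f s w" if "w \<le> a" "w \<noteq> c" for w using below[of w] that True by auto
      moreover have "AE w in N. w \<noteq> c"
      proof -
        have "AE w in lborel. w \<noteq> c" by (rule AE_lborel_singleton)
        then show ?thesis by (subst AE_density) auto
      qed
      ultimately show "AE w in N. indicator {..a} w * ennreal (f r w) \<le> indicator {..a} w * ennreal (f s w)"
        by (auto elim!: eventually_mono simp: indicator_def intro!: ennreal_leI)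
      show "\<not> (AE w in N. indicator {..a} w * ennreal (f s w) \<le> indicator {..a} w * ennreal (f r w))"
      proof
        assume "AE w in N. indicator {..a} w * ennreal (f s w) \<le> indicator {..a} w * ennreal (f r w)"
        from AE_N_interval[OF this, of "a - 1" a] obtain w where w: "w < a" "f s w \<le> f r w"
          using pos by (auto simp: indicator_def)
        then show False using below[of w] True by auto
      qed
    qed (use bound rs in auto)
    then show False using eq' by simp
  next
    case False
    have "(\<integral>\<^sup>+w. indicator {a<..} w * ennreal (f s w) \<partial>N) < (\<integral>\<^sup>+w. indicator {a<..} w * ennreal (f r w) \<partial>N)"
    proof (rule nn_integral_less)
      have "f s w \<le> f r w" if "w > a" for w using above[of w] that False by auto
      then show "AE w in N. indicator {a<..} w * ennreal (f s w) \<le> indicator {a<..} w * ennreal (f r w)"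
        by (auto simp: indicator_def intro!: ennreal_leI)
      show "\<not> (AE w in N. indicator {a<..} w * ennreal (f r w) \<le> indicator {a<..} w * ennreal (f s w))"
      proof
        assume "AE w in N. indicator {a<..} w * ennreal (f r w) \<le> indicator {a<..} w * ennreal (f s w)"
        from AE_N_interval[OF this, of a "a + 1"] obtain w where w: "w > a" "f r w \<le> f s w"
          using pos by (auto simp: indicator_def)
        then show False using above[of w] False by auto
      qed
    qed (use bound rs in auto)
    moreover have split: "(\<integral>\<^sup>+w. ennreal (f r w) \<partial>N) = (\<integral>\<^sup>+w. indicator {..a} w * ennreal (f r w) \<partial>N)
        + (\<integral>\<^sup>+w. indicator {a<..} w * ennreal (f r w) \<partial>N)" for r
      by (subst nn_integral_add[symmetric]) (auto intro!: nn_integral_cong simp: indicator_def)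
    moreover have "(\<integral>\<^sup>+w. indicator {a<..} w * ennreal (f r w) \<partial>N) = (\<integral>\<^sup>+w. indicator {a<..} w * ennreal (f s w) \<partial>N)"
      using split[of r] split[of s] total[OF rs(2)] total[OF rs(3)] eq' bound[OF rs(3), of "{..a}"]
      by (simp add: ennreal_add_left_cancel)
    ultimately show False by simp
  qed
qed

lemma orthant_inject:
  assumes "orthant a b r = orthant a b s" "r\<^sup>2 < 1" "s\<^sup>2 < 1"
  shows "r = s"
  using orthant_neq_if_less assms by (metis linorder_neq_iff)

section \<open>Thresholds and correlations are determined by the responses\<close>

text \<open>
  Integrating out the second coordinate of \<open>mvn_pair_integral\<close> leaves a one-dimensional
  mixture of two probits, which the rotation turns into an orthant probability. Its arguments are
  the thresholds and the correlation of \<open>e - u \<bullet> x\<close> and \<open>e' - v \<bullet> x\<close>, where \<open>e, e'\<close>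
  are the independent standard normal variables behind the two probits.
\<close>

lemma mvn_probit_integrals:
  fixes S :: "real^'n^'n" and k1 k2 :: 'n and u v :: "real^'n"
  assumes S: "pos_def_matrix S" and k: "k1 \<noteq> k2"
  defines "U \<equiv> sqrt (1 + u \<bullet> (S *v u))" and "V \<equiv> sqrt (1 + v \<bullet> (S *v v))" and "r \<equiv> u \<bullet> (S *v v)"
  shows "emeasure (mvn S) UNIV \<noteq> 0" "emeasure (mvn S) UNIV \<noteq> \<infinity>"
    "(\<integral>\<^sup>+x. ennreal (Phi (d + u \<bullet> x)) \<partial>mvn S) = emeasure (mvn S) UNIV * ennreal (Phi (d / U))"
    "(\<integral>\<^sup>+x. ennreal (Phi (d + u \<bullet> x)) * ennreal (Phi (e + v \<bullet> x)) \<partial>mvn S)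
      = emeasure (mvn S) UNIV * orthant (d / U) (e / V) (r / (U * V))"
    "(r / (U * V))\<^sup>2 < 1"
proof -
  obtain \<alpha> \<beta> \<gamma> where uv: "u \<bullet> (S *v u) = \<alpha>\<^sup>2" "u \<bullet> (S *v v) = \<alpha> * \<beta>" "v \<bullet> (S *v v) = \<beta>\<^sup>2 + \<gamma>\<^sup>2"
    and m: "emeasure (mvn S) UNIV \<noteq> 0" "emeasure (mvn S) UNIV \<noteq> \<infinity>"
    and int: "\<And>h. h \<in> borel_measurable (borel \<Otimes>\<^sub>M borel) \<Longrightarrow> (\<integral>\<^sup>+x. h (u \<bullet> x, v \<bullet> x) \<partial>mvn S)
      = emeasure (mvn S) UNIV * (\<integral>\<^sup>+s. \<integral>\<^sup>+t. h (\<alpha> * s, \<beta> * s + \<gamma> * t) \<partial>N \<partial>N)"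
    using mvn_pair_integral[OF S k, of u v] by blast
  show "emeasure (mvn S) UNIV \<noteq> 0" "emeasure (mvn S) UNIV \<noteq> \<infinity>" by (fact m)+
  have U: "U > 0" "U\<^sup>2 = 1 + \<alpha>\<^sup>2" "U = sqrt (1 + \<alpha>\<^sup>2)"
    by (auto simp: U_def uv add_pos_nonneg)
  have V: "V > 0" "V\<^sup>2 = 1 + \<beta>\<^sup>2 + \<gamma>\<^sup>2"
    by (auto simp: V_def uv add_pos_nonneg add.assoc)
  have [simp]: "emeasure N UNIV = 1" using N.emeasure_space_1 by simp
  have "(\<integral>\<^sup>+x. ennreal (Phi (d + u \<bullet> x)) \<partial>mvn S)
    = emeasure (mvn S) UNIV * (\<integral>\<^sup>+s. \<integral>\<^sup>+t. ennreal (Phi (d + \<alpha> * s)) \<partial>N \<partial>N)"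
    using int[of "\<lambda>(a, b). ennreal (Phi (d + a))"] by simp
  then show "(\<integral>\<^sup>+x. ennreal (Phi (d + u \<bullet> x)) \<partial>mvn S) = emeasure (mvn S) UNIV * ennreal (Phi (d / U))"
    by (simp add: Phi_mixture U(3))
  define c where "c = sqrt (1 + \<gamma>\<^sup>2)"
  have c: "c > 0" "c\<^sup>2 = 1 + \<gamma>\<^sup>2" by (auto simp: c_def add_pos_nonneg)
  define D where "D = sqrt (U\<^sup>2 * c\<^sup>2 + \<beta>\<^sup>2)"
  have pos: "U\<^sup>2 * c\<^sup>2 + \<beta>\<^sup>2 > 0" using U(1) c(1) by (intro add_pos_nonneg) auto
  have D: "D > 0" using pos by (simp add: D_def)
  have one_minus: "1 - (r / (U * V))\<^sup>2 = (U\<^sup>2 * c\<^sup>2 + \<beta>\<^sup>2) / (U * V)\<^sup>2"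
  proof -
    have "(U * V)\<^sup>2 - r\<^sup>2 = U\<^sup>2 * c\<^sup>2 + \<beta>\<^sup>2"
      unfolding r_def uv power_mult_distrib U(2) V(2) c(2) by algebra
    moreover have "1 - (r / (U * V))\<^sup>2 = ((U * V)\<^sup>2 - r\<^sup>2) / (U * V)\<^sup>2"
      using U(1) V(1) by (simp add: power_divide diff_divide_distrib)
    ultimately show ?thesis by simp
  qed
  have "(U\<^sup>2 * c\<^sup>2 + \<beta>\<^sup>2) / (U * V)\<^sup>2 > 0" using pos U(1) V(1) by simp
  then show "(r / (U * V))\<^sup>2 < 1" using one_minus by simp
  have slope: "(e / V - r / (U * V) * w) / sqrt (1 - (r / (U * V))\<^sup>2)
    = (e / c + \<beta> / c * (- (\<alpha> * w) / U)) / sqrt (1 + (\<beta> / c / U)\<^sup>2)" for w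
  proof -
    \<comment> \<open>Both denominators are expressed through \<open>D\<close>, the square root of \<open>U\<^sup>2 V\<^sup>2 - r\<^sup>2\<close>.\<close>
    have 1: "sqrt (1 - (r / (U * V))\<^sup>2) = D / (U * V)"
      unfolding one_minus D_def using U(1) V(1) by (simp add: real_sqrt_divide)
    have "1 + (\<beta> / c / U)\<^sup>2 = (U\<^sup>2 * c\<^sup>2 + \<beta>\<^sup>2) / (U * c)\<^sup>2"
      using U(1) c(1) by (simp add: power_divide power_mult_distrib field_simps)
    then have 2: "sqrt (1 + (\<beta> / c / U)\<^sup>2) = D / (U * c)"
      unfolding D_def using U(1) c(1) by (simp add: real_sqrt_divide)
    show ?thesis unfolding 1 2 unfolding r_def uv using U(1) V(1) c(1) D by (simp add: field_simps)
  qed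
  have "(\<integral>\<^sup>+x. ennreal (Phi (d + u \<bullet> x)) * ennreal (Phi (e + v \<bullet> x)) \<partial>mvn S)
    = emeasure (mvn S) UNIV * (\<integral>\<^sup>+s. \<integral>\<^sup>+t. ennreal (Phi (d + \<alpha> * s)) * ennreal (Phi (e + \<beta> * s + \<gamma> * t)) \<partial>N \<partial>N)"
    using int[of "\<lambda>(a, b). ennreal (Phi (d + a)) * ennreal (Phi (e + b))"] by (simp add: add.assoc)
  also have "(\<integral>\<^sup>+s. \<integral>\<^sup>+t. ennreal (Phi (d + \<alpha> * s)) * ennreal (Phi (e + \<beta> * s + \<gamma> * t)) \<partial>N \<partial>N)
    = (\<integral>\<^sup>+s. ennreal (Phi (d + \<alpha> * s)) * ennreal (Phi (e / c + \<beta> / c * s)) \<partial>N)"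
    by (intro nn_integral_cong, subst nn_integral_cmult)
      (auto simp: Phi_mixture add_divide_distrib c_def)
  also have "\<dots> = (\<integral>\<^sup>+w. indicator {..d / U} w *
      (\<integral>\<^sup>+y. ennreal (Phi ((e / c + \<beta> / c * (- (\<alpha> * w) / U)) + (\<beta> / c / U) * y)) \<partial>N) \<partial>N)"
    unfolding U(3) by (subst rotation_integral)
      (auto simp: diff_divide_distrib algebra_simps intro!: nn_integral_cong)
  also have "\<dots> = orthant (d / U) (e / V) (r / (U * V))"
    unfolding Phi_mixture orthant_def slope ..
  finally show "(\<integral>\<^sup>+x. ennreal (Phi (d + u \<bullet> x)) * ennreal (Phi (e + v \<bullet> x)) \<partial>mvn S)
      = emeasure (mvn S) UNIV * orthant (d / U) (e / V) (r / (U * V))" .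
qed

lemma sets_mvn [simp, measurable_cong]: "sets (mvn S) = sets borel"
  and space_mvn [simp]: "space (mvn S) = UNIV"
  by (simp_all add: mvn_def)

definition linear_predictor ::
  "('j::finite \<Rightarrow> 'g::finite) \<Rightarrow> real^('g option)^'j \<Rightarrow> real^'j \<Rightarrow> real^('g option) \<Rightarrow> 'j \<Rightarrow> real"
where
  "linear_predictor gof A d eta j =
     d $ j + A $ j $ None * eta $ None + A $ j $ Some (gof j) * eta $ Some (gof j)"

lemma linear_predictor_measurable [measurable]:
  "(\<lambda>eta. linear_predictor gof A d eta j) \<in> borel_measurable borel"
  unfolding linear_predictor_def by (intro borel_measurable_continuous_onI continuous_intros)

lemma cond_response_pmf_altdef:
  "cond_response_pmf gof A d eta =
     Pi_pmf UNIV False (\<lambda>j. bernoulli_pmf (Phi (linear_predictor gof A d eta j)))"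
  by (simp add: cond_response_pmf_def linear_predictor_def)

lemma cond_response_measurable:
  fixes gof :: "'j::finite \<Rightarrow> 'g::finite"
  shows "(\<lambda>eta. measure_pmf (cond_response_pmf gof A d eta)) \<in> borel \<rightarrow>\<^sub>M subprob_algebra (count_space UNIV)"
proof (rule measurable_subprob_algebra)
  fix Y :: "('j \<Rightarrow> bool) set"
  have bern: "(\<lambda>eta. pmf (bernoulli_pmf (Phi (linear_predictor gof A d eta j))) b) \<in> borel_measurable borel" for j b
    by (cases b) (simp_all add: Phi_bounds)
  have "(\<lambda>eta. emeasure (measure_pmf (cond_response_pmf gof A d eta)) Y)
      = (\<lambda>eta. \<Sum>y\<in>Y. ennreal (\<Prod>j\<in>UNIV. pmf (bernoulli_pmf (Phi (linear_predictor gof A d eta j))) (y j)))"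
    by (simp add: emeasure_measure_pmf_finite cond_response_pmf_altdef pmf_Pi prod_nonneg)
  also have "\<dots> \<in> borel_measurable borel"
    using bern by (intro borel_measurable_sum measurable_compose[OF _ measurable_ennreal] borel_measurable_prod)
  finally show "(\<lambda>eta. emeasure (measure_pmf (cond_response_pmf gof A d eta)) Y) \<in> borel_measurable borel" .
qed (auto intro: prob_space_imp_subprob_space measure_pmf.prob_space_axioms)

lemma response_all_correct:
  "emeasure (response_distribution gof (A, d, SG)) {y. \<forall>j\<in>I. y j}
    = (\<integral>\<^sup>+eta. (\<Prod>j\<in>I. ennreal (Phi (linear_predictor gof A d eta j))) \<partial>mvn (full_cov SG))"
proof -
  have "emeasure (response_distribution gof (A, d, SG)) {y. \<forall>j\<in>I. y j}
    = (\<integral>\<^sup>+eta. emeasure (measure_pmf (cond_response_pmf gof A d eta)) {y. \<forall>j\<in>I. y j} \<partial>mvn (full_cov SG))"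
    unfolding response_distribution_def prod.case
    by (rule emeasure_bind[where N="count_space UNIV"])
      (use cond_response_measurable in \<open>auto simp: measurable_cong_sets[OF sets_mvn refl]\<close>)
  also have "\<dots> = (\<integral>\<^sup>+eta. (\<Prod>j\<in>I. ennreal (Phi (linear_predictor gof A d eta j))) \<partial>mvn (full_cov SG))"
  proof (rule nn_integral_cong)
    fix eta
    let ?B = "\<lambda>j. if j \<in> I then {True} else UNIV"
    have "{y. \<forall>j\<in>I. y j} = Pi UNIV ?B" by (auto simp: Pi_def)
    then have "measure_pmf.prob (cond_response_pmf gof A d eta) {y. \<forall>j\<in>I. y j}
      = (\<Prod>j\<in>UNIV. measure_pmf.prob (bernoulli_pmf (Phi (linear_predictor gof A d eta j))) (?B j))"
      unfolding cond_response_pmf_altdef by (simp add: measure_Pi_pmf_Pi)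
    also have "\<dots> = (\<Prod>j\<in>UNIV. if j \<in> I then Phi (linear_predictor gof A d eta j) else 1)"
      by (intro prod.cong) (auto simp: measure_pmf_single Phi_bounds)
    also have "\<dots> = (\<Prod>j\<in>I. Phi (linear_predictor gof A d eta j))"
      by (simp add: prod.If_cases)
    finally show "emeasure (measure_pmf (cond_response_pmf gof A d eta)) {y. \<forall>j\<in>I. y j}
      = (\<Prod>j\<in>I. ennreal (Phi (linear_predictor gof A d eta j)))"
      by (simp add: measure_pmf.emeasure_eq_measure prod_ennreal Phi_bounds)
  qed
  finally show ?thesis .
qed

lemma sum_option_UNIV: "(\<Sum>k\<in>UNIV. f k) = f None + (\<Sum>g\<in>UNIV. f (Some g))"
  for f :: "'g::finite option \<Rightarrow> real"
  by (simp add: UNIV_option_conv sum.reindex)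

lemma full_cov_mult:
  "(full_cov SG *v x) $ None = x $ None"
  "(full_cov SG *v x) $ Some g = (SG *v (\<chi> h. x $ Some h)) $ g"
  by (simp_all add: matrix_vector_mult_def full_cov_def sum_option_UNIV)

lemma pos_def_entry_sym:
  fixes S :: "real^'n^'n"
  assumes "pos_def_matrix S"
  shows "S $ g $ h = S $ h $ g"
proof -
  have "transpose S $ h $ g = S $ h $ g" using assms by (simp add: pos_def_matrix_def)
  then show ?thesis by (simp add: transpose_def)
qed

lemma pos_def_full_cov:
  assumes "pos_def_matrix SG"
  shows "pos_def_matrix (full_cov SG)"
  unfolding pos_def_matrix_def
proof (intro conjI allI impI)
  have "full_cov SG $ l $ k = full_cov SG $ k $ l" for k l
    by (cases k; cases l) (simp_all add: full_cov_def pos_def_entry_sym[OF assms])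
  then show "transpose (full_cov SG) = full_cov SG"
    unfolding vec_eq_iff transpose_def by simp
next
  fix x :: "real^'a option"
  assume "x \<noteq> 0"
  define y where "y = (\<chi> h. x $ Some h)"
  have eq: "x \<bullet> (full_cov SG *v x) = (x $ None)\<^sup>2 + y \<bullet> (SG *v y)"
    by (simp add: inner_vec_def sum_option_UNIV full_cov_mult y_def power2_eq_square)
  have "y = 0 \<Longrightarrow> x $ None \<noteq> 0"
    using \<open>x \<noteq> 0\<close> by (metis y_def vec_eq_iff vec_lambda_beta zero_index option.exhaust)
  moreover have "y \<noteq> 0 \<Longrightarrow> y \<bullet> (SG *v y) > 0" using assms by (simp add: pos_def_matrix_def)
  ultimately show "x \<bullet> (full_cov SG *v x) > 0"
    unfolding eq by (cases "y = 0") (auto intro: add_nonneg_pos)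
qed

lemma sum_single_support:
  fixes f :: "'g::finite \<Rightarrow> real"
  assumes "\<And>h. h \<noteq> g \<Longrightarrow> f h = 0"
  shows "(\<Sum>h\<in>UNIV. f h) = f g"
  using sum.mono_neutral_right[of UNIV "{g}" f] assms by auto

lemma bifactor_inner:
  fixes x y :: "real^('g::finite option)"
  assumes x: "\<And>k. k \<noteq> g \<Longrightarrow> x $ Some k = 0"
  shows "x \<bullet> y = x $ None * y $ None + x $ Some g * y $ Some g"
  using sum_single_support[of g "\<lambda>k. x $ Some k * y $ Some k"] x
  by (simp add: inner_vec_def sum_option_UNIV)

lemma bifactor_covariance:
  fixes x y :: "real^('g::finite option)"
  assumes x: "\<And>k. k \<noteq> g \<Longrightarrow> x $ Some k = 0" and y: "\<And>k. k \<noteq> h \<Longrightarrow> y $ Some k = 0"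
  shows "x \<bullet> (full_cov SG *v y) = x $ None * y $ None + SG $ g $ h * x $ Some g * y $ Some h"
proof -
  have "(SG *v (\<chi> k. y $ Some k)) $ g = SG $ g $ h * y $ Some h"
    using sum_single_support[of h "\<lambda>k. SG $ g $ k * y $ Some k"] y
    by (simp add: matrix_vector_mult_def)
  then show ?thesis by (simp add: bifactor_inner[OF x] full_cov_mult mult.left_commute)
qed

text \<open>
  The standard deviation of the latent variable \<open>e\<^sub>j - \<langle>A\<^sub>j, \<eta>\<rangle>\<close> that is compared with
  the intercept \<open>d\<^sub>j\<close>. The two latent dimensions that enter it are uncorrelated with variance 1.
\<close>

definition item_scale :: "('j \<Rightarrow> 'g) \<Rightarrow> real^('g::finite option)^'j \<Rightarrow> 'j \<Rightarrow> real" where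
  "item_scale gof A j = sqrt (1 + (A $ j $ None)\<^sup>2 + (A $ j $ Some (gof j))\<^sup>2)"

definition main_std where "main_std gof A j = A $ j $ None / item_scale gof A j"
definition testlet_std where "testlet_std gof A j = A $ j $ Some (gof j) / item_scale gof A j"

lemma item_scale_pos: "item_scale gof A j > 0"
  by (simp add: item_scale_def add_pos_nonneg)

definition item_correlation where
  "item_correlation gof A SG i j = main_std gof A i * main_std gof A j
     + SG $ gof i $ gof j * testlet_std gof A i * testlet_std gof A j"

text \<open>
  The first and second order margins of the response distribution. All of them carry the mass
  \<open>m\<close> of the latent distribution as a factor, which is itself the mass of the response
  distribution.
\<close>

lemma response_margins:
  assumes "(A, d, SG) \<in> param_space gof"
  defines "m \<equiv> emeasure (mvn (full_cov SG)) UNIV" and "R \<equiv> response_distribution gof (A, d, SG)"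
  shows "m \<noteq> 0" "m \<noteq> \<infinity>" "emeasure R UNIV = m"
    "emeasure R {y. y j} = m * ennreal (Phi (d $ j / item_scale gof A j))"
    "i \<noteq> j \<Longrightarrow> emeasure R {y. y i \<and> y j}
      = m * orthant (d $ i / item_scale gof A i) (d $ j / item_scale gof A j) (item_correlation gof A SG i j)"
    "i \<noteq> j \<Longrightarrow> (item_correlation gof A SG i j)\<^sup>2 < 1"
proof -
  have sparse: "\<And>j k. k \<noteq> gof j \<Longrightarrow> A $ j $ Some k = 0" and pd: "pos_def_matrix SG"
    and diag: "\<And>g. SG $ g $ g = 1"
    using assms(1) by (auto simp: param_space_def)
  have pred: "linear_predictor gof A d eta j = d $ j + A $ j \<bullet> eta" for eta j
    using bifactor_inner[of "gof j" "A $ j" eta] sparse by (simp add: linear_predictor_def)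
  have cov: "A $ i \<bullet> (full_cov SG *v A $ j)
    = A $ i $ None * A $ j $ None + SG $ gof i $ gof j * A $ i $ Some (gof i) * A $ j $ Some (gof j)" for i j
    by (rule bifactor_covariance) (simp_all add: sparse)
  have var: "sqrt (1 + A $ j \<bullet> (full_cov SG *v A $ j)) = item_scale gof A j" for j
    by (simp add: cov diag item_scale_def power2_eq_square)
  have corr: "A $ i \<bullet> (full_cov SG *v A $ j) / (item_scale gof A i * item_scale gof A j)
    = item_correlation gof A SG i j" for i j
    by (simp add: cov item_correlation_def main_std_def testlet_std_def add_divide_distrib)
  note M = mvn_probit_integrals[OF pos_def_full_cov[OF pd], of None "Some (gof j)"]
  show "m \<noteq> 0" "m \<noteq> \<infinity>" using M(1,2) by (simp_all add: m_def)
  show "emeasure R UNIV = m"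
    using response_all_correct[of gof A d SG "{}"] by (simp add: R_def m_def)
  show "emeasure R {y. y j} = m * ennreal (Phi (d $ j / item_scale gof A j))"
    using response_all_correct[of gof A d SG "{j}"] M(3)[of "d $ j" "A $ j"]
    by (simp add: R_def m_def pred var)
  assume "i \<noteq> j"
  then show "emeasure R {y. y i \<and> y j}
      = m * orthant (d $ i / item_scale gof A i) (d $ j / item_scale gof A j) (item_correlation gof A SG i j)"
    using response_all_correct[of gof A d SG "{i, j}"] M(4)[of "d $ i" "A $ i" "d $ j" "A $ j"]
    by (simp add: R_def m_def pred var corr)
  show "(item_correlation gof A SG i j)\<^sup>2 < 1"
    using M(5)[of "A $ i" "A $ j"] by (simp add: var corr)
qed

text \<open>
  The common mass cancels. The thresholds are compared first, by strict monotonicity of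
  \<open>Phi\<close>; the orthant probabilities then differ only in their correlation.
\<close>

lemma response_determines_polychoric:
  assumes p: "(A, d, SG) \<in> param_space gof" and p': "(A', d', SG') \<in> param_space gof"
    and eq: "response_distribution gof (A', d', SG') = response_distribution gof (A, d, SG)"
  shows "d $ j / item_scale gof A j = d' $ j / item_scale gof A' j"
    "i \<noteq> j \<Longrightarrow> item_correlation gof A SG i j = item_correlation gof A' SG' i j"
proof -
  note R = response_margins[OF p] and R' = response_margins[OF p', unfolded eq]
  have m: "emeasure (mvn (full_cov SG')) UNIV = emeasure (mvn (full_cov SG)) UNIV"
    using R(3) R'(3) by simp
  have tau: "d $ j / item_scale gof A j = d' $ j / item_scale gof A' j" for j
    using R(4)[of j] R'(4)[of j] R(1,2) unfolding m by (simp add: ennreal_mult_cancel_left Phi_bounds)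
  then show "d $ j / item_scale gof A j = d' $ j / item_scale gof A' j" .
  assume ij: "i \<noteq> j"
  have "orthant (d $ i / item_scale gof A i) (d $ j / item_scale gof A j) (item_correlation gof A SG i j)
    = orthant (d $ i / item_scale gof A i) (d $ j / item_scale gof A j) (item_correlation gof A' SG' i j)"
    using R(5)[OF ij] R'(5)[OF ij] R(1,2) unfolding m tau by (simp add: ennreal_mult_cancel_left)
  from orthant_inject[OF this R(6)[OF ij] R'(6)[OF ij]]
  show "item_correlation gof A SG i j = item_correlation gof A' SG' i j" .
qed

section \<open>Two bifactor loadings with the same covariances\<close>

text \<open>
  The rows \<open>(x j, y j)\<close> with \<open>j \<in> B\<close> span the plane, expressed by a nonzero minor.
\<close>

definition spanning :: "('j \<Rightarrow> real) \<Rightarrow> ('j \<Rightarrow> real) \<Rightarrow> 'j set \<Rightarrow> bool" where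
  "spanning x y B \<longleftrightarrow> (\<exists>p\<in>B. \<exists>q\<in>B. x p * y q \<noteq> x q * y p)"

lemma linear_form_zero:
  assumes "spanning x y B" "\<And>i. i \<in> B \<Longrightarrow> a * x i + b * y i = 0"
  shows "a = 0 \<and> b = 0"
proof -
  obtain p q where pq: "p \<in> B" "q \<in> B" "x p * y q - x q * y p \<noteq> 0"
    using assms(1) unfolding spanning_def by auto
  have "a * x p + b * y p = 0" "a * x q + b * y q = 0"
    using assms(2) pq by auto
  then have "a * (x p * y q - x q * y p) = 0" "b * (x p * y q - x q * y p) = 0"
    by algebra+
  with pq show ?thesis by simp
qed

lemma spanning_nonzero:
  assumes "spanning x y B"
  shows "\<exists>k\<in>B. x k \<noteq> 0"
  using linear_form_zero[OF assms, of 1 0] by auto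

lemma bilinear_form_zero:
  assumes "spanning x y B" "spanning u v C"
    and "\<And>i j. i \<in> B \<Longrightarrow> j \<in> C \<Longrightarrow> a * x i * u j + b * x i * v j + c * y i * u j + e * y i * v j = 0"
  shows "a = 0 \<and> b = 0 \<and> c = 0 \<and> e = 0"
proof -
  have *: "a * u j + b * v j = 0 \<and> c * u j + e * v j = 0" if "j \<in> C" for j
  proof (rule linear_form_zero[OF assms(1)])
    show "(a * u j + b * v j) * x i + (c * u j + e * v j) * y i = 0" if "i \<in> B" for i
      using assms(3)[OF that \<open>j \<in> C\<close>] by (simp add: algebra_simps)
  qed
  show ?thesis
    using linear_form_zero[OF assms(2), of a b] linear_form_zero[OF assms(2), of c e] * by blast
qed

lemma collinear_representation:
  assumes "\<not> spanning x y B"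
  obtains u :: "'j \<Rightarrow> real" and a b where "\<And>i. i \<in> B \<Longrightarrow> x i = u i * a" "\<And>i. i \<in> B \<Longrightarrow> y i = u i * b"
proof (cases "\<exists>k\<in>B. x k \<noteq> 0 \<or> y k \<noteq> 0")
  case False
  then show ?thesis by (intro that[of "\<lambda>_. 0" 0 0]) auto
next
  case True
  then obtain k where k: "k \<in> B" "x k \<noteq> 0 \<or> y k \<noteq> 0" by auto
  have m: "x i * y k = x k * y i" if "i \<in> B" for i
    using assms that k(1) unfolding spanning_def by blast
  show ?thesis
  proof (cases "x k = 0")
    case True
    then show ?thesis using m k by (intro that[of "\<lambda>i. y i / y k" "x k" "y k"]) auto
  next
    case False
    then show ?thesis using m k
      by (intro that[of "\<lambda>i. x i / x k" "x k" "y k"]) (auto simp: field_simps)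
  qed
qed

text \<open>
  Two solutions \<open>(x, y, s)\<close> and \<open>(x', y', s')\<close> of the correlation equations: the
  unprimed one stands for the true parameters, whose loadings are restricted, the primed one for
  arbitrary competitors.
\<close>

locale equivalent_loadings =
  fixes gof :: "'j::finite \<Rightarrow> 'g"
    and x y x' y' :: "'j \<Rightarrow> real"
    and s s' :: "'g \<Rightarrow> 'g \<Rightarrow> real"
  assumes same_covariance: "i \<noteq> j \<Longrightarrow>
      x i * x j + s (gof i) (gof j) * y i * y j = x' i * x' j + s' (gof i) (gof j) * y' i * y' j"
    and unit_diag: "s g g = 1" "s' g g = 1"
    and symmetric: "s g h = s h g" "s' g h = s' h g"
    and less_one: "g \<noteq> h \<Longrightarrow> (s g h)\<^sup>2 < 1" "g \<noteq> h \<Longrightarrow> (s' g h)\<^sup>2 < 1"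
    and three_loadings: "card {j. gof j = g \<and> y j \<noteq> 0} \<ge> 3"
begin

abbreviation full_rank where "full_rank g \<equiv> spanning x y (gof -` {g})"
abbreviation full_rank' where "full_rank' g \<equiv> spanning x' y' (gof -` {g})"

definition scaled :: "'g \<Rightarrow> real \<Rightarrow> bool" where
  "scaled g t \<longleftrightarrow> (\<forall>i. gof i = g \<longrightarrow> x' i = t * x i)"

text \<open>
  On testlet \<open>g\<close> the rows satisfy \<open>(x', y') = (x, y) R\<close> with
  \<open>R = ((p, q), (r, t))\<close>.
\<close>

definition basis_change :: "'g \<Rightarrow> real \<Rightarrow> real \<Rightarrow> real \<Rightarrow> real \<Rightarrow> bool" where
  "basis_change g p q r t \<longleftrightarrow>
     (\<forall>i. gof i = g \<longrightarrow> x' i = p * x i + r * y i \<and> y' i = q * x i + t * y i)"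

lemma scaledD: "scaled g t \<Longrightarrow> gof i = g \<Longrightarrow> x' i = t * x i"
  by (simp add: scaled_def)

lemma basis_changeD:
  assumes "basis_change g p q r t" "gof i = g"
  shows "x' i = p * x i + r * y i" "y' i = q * x i + t * y i"
  using assms by (auto simp: basis_change_def)

lemma third_loading:
  obtains r where "gof r = g" "y r \<noteq> 0" "r \<noteq> p" "r \<noteq> q"
proof -
  have "\<not> {j. gof j = g \<and> y j \<noteq> 0} \<subseteq> {p, q}"
    using three_loadings[of g] card_mono[of "{p,q}" "{j. gof j = g \<and> y j \<noteq> 0}"]
      card_insert_le_m1[of 2 "{q}" p] by fastforce
  then show ?thesis using that by auto
qed

lemma within:
  assumes "gof i = g" "gof j = g" "i \<noteq> j"
  shows "x i * x j + y i * y j = x' i * x' j + y' i * y' j"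
  using same_covariance[of i j] assms unit_diag by simp

lemma across:
  assumes "gof i = g" "gof j = h" "g \<noteq> h"
  shows "x i * x j + s g h * y i * y j = x' i * x' j + s' g h * y' i * y' j"
  using same_covariance[of i j] assms by auto

text \<open>
  The products of distinct entries determine a vector with three nonzero entries up to a factor:
  compare \<open>p\<close> and \<open>q\<close> through a third item \<open>r\<close>.
\<close>

lemma proportional_if_off_diagonal:
  assumes off: "\<And>i j. gof i = g \<Longrightarrow> gof j = g \<Longrightarrow> i \<noteq> j \<Longrightarrow> y i * y j = c * u i * u j"
    and "gof p = g" "gof q = g"
  shows "u p * y q = u q * y p"
proof (cases "p = q")
  case False
  obtain r where r: "gof r = g" "y r \<noteq> 0" "r \<noteq> p" "r \<noteq> q" by (rule third_loading)
  have "y q * y r = c * u q * u r" "y p * y r = c * u p * u r" using off r assms(2-) by auto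
  then have "(u p * y q - u q * y p) * y r = 0" by algebra
  then show ?thesis using r by auto
qed simp

lemma same_up_to_sign_if_off_diagonal:
  assumes off: "\<And>i j. gof i = g \<Longrightarrow> gof j = g \<Longrightarrow> i \<noteq> j \<Longrightarrow> y i * y j = u i * u j"
  obtains e where "e\<^sup>2 = 1" "\<And>i. gof i = g \<Longrightarrow> u i = e * y i"
proof -
  have pr: "u p * y q = u q * y p" if "gof p = g" "gof q = g" for p q
    by (rule proportional_if_off_diagonal[where c=1 and u=u and g=g]) (use off that in auto)
  obtain p where p: "gof p = g" "y p \<noteq> 0" by (rule third_loading)
  obtain q where q: "gof q = g" "y q \<noteq> 0" "q \<noteq> p" by (rule third_loading)
  define e where "e = u p / y p"
  have ue: "u i = e * y i" if "gof i = g" for i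
    using pr[OF p(1) that] p unfolding e_def by (simp add: field_simps)
  have "y p * y q = u p * u q" using off p q by auto
  then have "y p * y q * (e\<^sup>2 - 1) = 0" using ue[OF p(1)] ue[OF q(1)] by algebra
  then have "e\<^sup>2 = 1" using p q by simp
  then show ?thesis using that ue by blast
qed

text \<open>
  Let \<open>p, q\<close> be items with independent rows and \<open>r\<close> a third one with a nonzero row
  \<open>\<lambda> p + \<mu> q\<close>. The form \<open>S\<close> vanishes on \<open>(p, q)\<close>, \<open>(p, r)\<close> and
  \<open>(q, r)\<close>, hence \<open>\<lambda> S(p, p) = 0\<close> and \<open>\<mu> S(q, q) = 0\<close>, and in the basis
  \<open>p, q\<close> it is diagonal with a zero on the diagonal. It can still be nonzero, namely when
  all rows but one are parallel.
\<close>

lemma quadratic_form_singular: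
  assumes "full_rank g"
    and off: "\<And>i j. gof i = g \<Longrightarrow> gof j = g \<Longrightarrow> i \<noteq> j \<Longrightarrow>
      a * x i * x j + b * (x i * y j + y i * x j) + c * y i * y j = 0"
  shows "a * c = b\<^sup>2"
proof -
  obtain p q where pq: "gof p = g" "gof q = g" "x p * y q - x q * y p \<noteq> 0"
    using assms(1) unfolding spanning_def by auto
  then have "p \<noteq> q" by auto
  obtain r where r: "gof r = g" "y r \<noteq> 0" "r \<noteq> p" "r \<noteq> q" by (rule third_loading)
  define m where "m = x p * y q - x q * y p"
  define S where "S i j = a * x i * x j + b * (x i * y j + y i * x j) + c * y i * y j" for i j
  have S: "S p q = 0" "S p r = 0" "S q r = 0" using off pq r \<open>p \<noteq> q\<close> by (auto simp: S_def)
  have det: "(a * c - b\<^sup>2) * m\<^sup>2 = S p p * S q q - (S p q)\<^sup>2"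
    unfolding S_def m_def by algebra
  have "m * S p r = (x r * y q - x q * y r) * S p p + (x p * y r - x r * y p) * S p q"
    "m * S q r = (x r * y q - x q * y r) * S p q + (x p * y r - x r * y p) * S q q"
    unfolding S_def m_def by algebra+
  then have *: "(x r * y q - x q * y r) * S p p = 0" "(x p * y r - x r * y p) * S q q = 0"
    using S by auto
  have "m * y r = (x r * y q - x q * y r) * y p + (x p * y r - x r * y p) * y q"
    unfolding m_def by algebra
  then have "S p p = 0 \<or> S q q = 0" using * r pq m_def by auto
  then have "(a * c - b\<^sup>2) * m\<^sup>2 = 0" using det S by auto
  then show ?thesis using pq m_def by auto
qed

lemma quadratic_form_zero:
  assumes off: "\<And>i j. gof i = g \<Longrightarrow> gof j = g \<Longrightarrow> i \<noteq> j \<Longrightarrow> c * y i * y j = 0"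
  shows "c = 0"
proof -
  obtain p where p: "gof p = g" "y p \<noteq> 0" by (rule third_loading)
  obtain q where q: "gof q = g" "y q \<noteq> 0" "q \<noteq> p" by (rule third_loading)
  show ?thesis using off[of p q] p q by auto
qed

text \<open>
  The Cauchy-Binet formula for the 2 by 2 minors of the covariance block between two testlets.
\<close>

lemma minor_identity:
  assumes "gof p = g" "gof q = g" "gof r = h" "gof t = h" "g \<noteq> h"
  shows "s g h * (x p * y q - x q * y p) * (x r * y t - x t * y r)
       = s' g h * (x' p * y' q - x' q * y' p) * (x' r * y' t - x' t * y' r)"
proof -
  note a = across[OF assms(1,3,5)] across[OF assms(1,4,5)] across[OF assms(2,3,5)] across[OF assms(2,4,5)]
  have "s g h * (x p * y q - x q * y p) * (x r * y t - x t * y r)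
    = (x p * x r + s g h * y p * y r) * (x q * x t + s g h * y q * y t)
    - (x p * x t + s g h * y p * y t) * (x q * x r + s g h * y q * y r)"
    by algebra
  also have "\<dots> = (x' p * x' r + s' g h * y' p * y' r) * (x' q * x' t + s' g h * y' q * y' t)
    - (x' p * x' t + s' g h * y' p * y' t) * (x' q * x' r + s' g h * y' q * y' r)"
    using a by simp
  also have "\<dots> = s' g h * (x' p * y' q - x' q * y' p) * (x' r * y' t - x' t * y' r)"
    by algebra
  finally show ?thesis .
qed

text \<open>
  If the competing rows on \<open>g\<close> were collinear, the covariance block between \<open>g\<close> and
  \<open>h\<close> would have rank at most 1. This forces \<open>s g h = 0\<close> and makes \<open>x\<close> proportional
  to the common direction \<open>u\<close>; the correlations inside \<open>g\<close> then make \<open>y\<close>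
  proportional to \<open>u\<close> as well.
\<close>

lemma full_transfers:
  assumes "full_rank g" "full_rank h" "g \<noteq> h"
  shows "full_rank' g"
proof (rule ccontr)
  assume nf: "\<not> full_rank' g"
  then obtain u a b where u: "\<And>i. gof i = g \<Longrightarrow> x' i = u i * a" "\<And>i. gof i = g \<Longrightarrow> y' i = u i * b"
    using collinear_representation[OF nf] by auto
  obtain p q where pq: "gof p = g" "gof q = g" "x p * y q - x q * y p \<noteq> 0"
    using assms(1) unfolding spanning_def by auto
  obtain r t where rt: "gof r = h" "gof t = h" "x r * y t - x t * y r \<noteq> 0"
    using assms(2) unfolding spanning_def by auto
  have "x' p * y' q - x' q * y' p = 0" using u pq by auto
  then have s0: "s g h = 0"
    using minor_identity[OF pq(1,2) rt(1,2) assms(3)] pq rt by auto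
  obtain j where j: "gof j = h" "x j \<noteq> 0" using rt by (cases "x r = 0") auto
  define k where "k = (a * x' j + s' g h * b * y' j) / x j"
  have xk: "x i = k * u i" if "gof i = g" for i
    using across[OF that j(1) assms(3)] s0 u[OF that] j(2) unfolding k_def
    by (simp add: field_simps)
  have "y i * y j = (a\<^sup>2 + b\<^sup>2 - k\<^sup>2) * u i * u j" if "gof i = g" "gof j = g" "i \<noteq> j" for i j
    using within[OF that] u[OF that(1)] u[OF that(2)] xk[OF that(1)] xk[OF that(2)]
    by (simp add: algebra_simps power2_eq_square)
  from proportional_if_off_diagonal[OF this pq(1,2)] have "u p * y q = u q * y p" .
  then show False using pq xk by simp
qed

text \<open>
  The block between \<open>g\<close> and \<open>h\<close> is the rank 1 matrix \<open>x\<^sub>i x\<^sub>j = x'\<^sub>i x'\<^sub>j\<close>, whose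
  factors are unique up to reciprocal scalings.
\<close>

lemma uncorrelated_scaling:
  assumes "full_rank g" "full_rank h" "g \<noteq> h" "s g h = 0"
  obtains t where "t \<noteq> 0" "scaled g t" "scaled h (1 / t)"
proof -
  have "full_rank' g" "full_rank' h" using full_transfers assms by metis+
  then obtain p q r t where pq: "gof p = g" "gof q = g" "x' p * y' q - x' q * y' p \<noteq> 0"
     and rt: "gof r = h" "gof t = h" "x' r * y' t - x' t * y' r \<noteq> 0"
    unfolding spanning_def by auto
  have s0: "s' g h = 0" using minor_identity[OF pq(1,2) rt(1,2) assms(3)] pq rt assms(4) by auto
  have prod: "x i * x j = x' i * x' j" if "gof i = g" "gof j = h" for i j
    using across[OF that assms(3)] s0 assms(4) by simp
  obtain k where k: "gof k = h" "x k \<noteq> 0"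
    using spanning_nonzero[OF assms(2)] by auto
  obtain l where l: "gof l = g" "x l \<noteq> 0"
    using spanning_nonzero[OF assms(1)] by auto
  have nz: "x' k \<noteq> 0" "x' l \<noteq> 0" using prod[OF l(1) k(1)] k l by auto
  define c where "c = x k / x' k"
  have c0: "c \<noteq> 0" using k nz by (simp add: c_def)
  have g: "x' i = c * x i" if "gof i = g" for i
    using prod[OF that k(1)] nz by (simp add: c_def field_simps)
  have "x' j = x j / c" if "gof j = h" for j
    using prod[OF l(1) that] g[OF l(1)] nz c0 l by (simp add: field_simps)
  then show ?thesis using that[of c] g c0 by (simp add: scaled_def)
qed

text \<open>
  The block between \<open>g\<close> and \<open>h\<close> has rank 2, so its column space is spanned by
  \<open>x, y\<close> as well as by \<open>x', y'\<close>. Two items of \<open>h\<close> with independent competing rows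
  give a linear system for \<open>(x'\<^sub>i, y'\<^sub>i)\<close>, solved by Cramer's rule.
\<close>

lemma correlated_change_of_basis:
  assumes "full_rank g" "full_rank h" "g \<noteq> h" "s g h \<noteq> 0"
  obtains p q r t where "basis_change g p q r t" "p * t - q * r \<noteq> 0" "s' g h \<noteq> 0"
proof -
  have fh: "full_rank' h" using full_transfers assms by metis
  obtain k l where kl: "gof k = h" "gof l = h" "x' k * y' l - x' l * y' k \<noteq> 0"
    using fh unfolding spanning_def by auto
  obtain a b where ab: "gof a = g" "gof b = g" "x a * y b - x b * y a \<noteq> 0"
    using assms(1) unfolding spanning_def by auto
  obtain m n where mn: "gof m = h" "gof n = h" "x m * y n - x n * y m \<noteq> 0"
    using assms(2) unfolding spanning_def by auto
  have ne: "s' g h * (x' a * y' b - x' b * y' a) \<noteq> 0"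
    using minor_identity[OF ab(1,2) mn(1,2) assms(3)] ab mn assms(4) by auto
  define M where "M = x' k * y' l - x' l * y' k"
  have M0: "M \<noteq> 0" using kl M_def by simp
  have s0: "s' g h \<noteq> 0" using ne by simp
  define p where "p = (x k * y' l - x l * y' k) / M"
  define r where "r = s g h * (y k * y' l - y l * y' k) / M"
  define q where "q = (x' k * x l - x' l * x k) / (s' g h * M)"
  define t where "t = s g h * (x' k * y l - x' l * y k) / (s' g h * M)"
  have X: "x' i = p * x i + r * y i" and Y: "y' i = q * x i + t * y i" if "gof i = g" for i
  proof -
    note ac = across[OF that kl(1) assms(3)] across[OF that kl(2) assms(3)]
    have "M * x' i = (x k * y' l - x l * y' k) * x i + s g h * (y k * y' l - y l * y' k) * y i"
      using ac unfolding M_def by algebra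
    then have "x' i = ((x k * y' l - x l * y' k) * x i + s g h * (y k * y' l - y l * y' k) * y i) / M"
      using M0 by (simp add: eq_divide_eq mult.commute)
    then show "x' i = p * x i + r * y i" unfolding p_def r_def by (simp add: add_divide_distrib)
    have "s' g h * M * y' i = (x' k * x l - x' l * x k) * x i + s g h * (x' k * y l - x' l * y k) * y i"
      using ac unfolding M_def by algebra
    then have "y' i = ((x' k * x l - x' l * x k) * x i + s g h * (x' k * y l - x' l * y k) * y i) / (s' g h * M)"
      using M0 s0 by (simp add: eq_divide_eq mult.commute)
    then show "y' i = q * x i + t * y i" unfolding q_def t_def by (simp add: add_divide_distrib)
  qed
  have "x' a * y' b - x' b * y' a = (p * t - q * r) * (x a * y b - x b * y a)"
    using X[OF ab(1)] X[OF ab(2)] Y[OF ab(1)] Y[OF ab(2)] by algebra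
  then have "p * t - q * r \<noteq> 0" using ne by auto
  then show ?thesis using that[of p q r t] X Y s0 by (simp add: basis_change_def)
qed


text \<open>
  The matrix identity \<open>R\<^sub>g diag(1, s') R\<^sub>h\<^sup>T = diag(1, s)\<close>, entry by entry.
\<close>

lemma change_of_basis_across:
  assumes "full_rank g" "full_rank h" "g \<noteq> h"
    and g: "basis_change g p q r t"
    and h: "basis_change h p2 q2 r2 t2"
  shows "p * p2 + s' g h * q * q2 = 1" "p * r2 + s' g h * q * t2 = 0"
    "r * p2 + s' g h * t * q2 = 0" "r * r2 + s' g h * t * t2 = s g h"
proof -
  have "(p * p2 + s' g h * q * q2 - 1) * x i * x j + (p * r2 + s' g h * q * t2) * x i * y j
      + (r * p2 + s' g h * t * q2) * y i * x j + (r * r2 + s' g h * t * t2 - s g h) * y i * y j = 0"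
    if "i \<in> gof -` {g}" "j \<in> gof -` {h}" for i j
  proof -
    have "gof i = g" "gof j = h" using that by auto
    from across[OF this assms(3)] basis_changeD[OF g this(1)] basis_changeD[OF h this(2)] show ?thesis by algebra
  qed
  from bilinear_form_zero[OF assms(1,2) this]
  show "p * p2 + s' g h * q * q2 = 1" "p * r2 + s' g h * q * t2 = 0"
    "r * p2 + s' g h * t * q2 = 0" "r * r2 + s' g h * t * t2 = s g h" by auto
qed

lemma change_of_basis_within:
  assumes "full_rank g"
    and g: "basis_change g p q r t"
    and "gof i = g" "gof j = g" "i \<noteq> j"
  shows "(p\<^sup>2 + q\<^sup>2 - 1) * x i * x j + (p * r + q * t) * (x i * y j + y i * x j) + (r\<^sup>2 + t\<^sup>2 - 1) * y i * y j = 0"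
  using within[OF assms(3-5)] basis_changeD[OF g assms(3)] basis_changeD[OF g assms(4)] by algebra

text \<open>
  Solves the identity \<open>R\<^sub>g diag(1, b) R\<^sub>h\<^sup>T = diag(1, a)\<close> for \<open>R\<^sub>h\<close> by inverting
  \<open>R\<^sub>g\<close>.
\<close>

lemma second_change_of_basis:
  fixes p q r t p2 q2 r2 t2 a b :: real
  assumes "p * p2 + b * q * q2 = 1" "p * r2 + b * q * t2 = 0"
    "r * p2 + b * t * q2 = 0" "r * r2 + b * t * t2 = a"
  shows "(p * t - q * r) * p2 = t" "(p * t - q * r) * r2 = - (q * a)"
    "b * (p * t - q * r) * q2 = - r" "b * (p * t - q * r) * t2 = p * a"
  using assms by algebra+

definition main_loadings_agree :: "'g \<Rightarrow> bool" where
  "main_loadings_agree g \<longleftrightarrow> (\<exists>t. t\<^sup>2 = 1 \<and> scaled g t)"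

text \<open>
  Pairs of items from the two halves \<open>B\<close> and \<open>C\<close> are distinct, so the covariances inside
  \<open>g\<close> give a complete rank 2 block. If \<open>g\<close> and \<open>h\<close> are uncorrelated, its minors
  force the scaling factor to be \<open>\<plusminus>1\<close>. Otherwise the block makes \<open>R\<^sub>g\<close> orthogonal,
  and singularity of \<open>R\<^sub>h R\<^sub>h\<^sup>T - 1\<close> on the other testlet excludes any rotation that
  moves the first axis, since \<open>\<bar>s g h\<bar> < 1\<close> and \<open>\<bar>s' g h\<bar> < 1\<close>.
\<close>

lemma main_loadings_agree_split_testlet:
  assumes "full_rank g" "full_rank h" "g \<noteq> h"
    and split: "spanning x y B" "spanning x y C" "B \<inter> C = {}" "B \<union> C \<subseteq> gof -` {g}"
  shows "main_loadings_agree g"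
proof (cases "s g h = 0")
  case True
  then obtain t where t: "scaled g t"
    using uncorrelated_scaling[OF assms(1-3) True] by blast
  have e: "y' i * y' j = (1 - t\<^sup>2) * x i * x j + y i * y j" if "i \<in> B" "j \<in> C" for i j
  proof -
    have "gof i = g" "gof j = g" "i \<noteq> j" using that split by auto
    from within[OF this] scaledD[OF t this(1)] scaledD[OF t this(2)] show ?thesis by algebra
  qed
  obtain a b where ab: "a \<in> B" "b \<in> B" "x a * y b - x b * y a \<noteq> 0"
    using split(1) unfolding spanning_def by auto
  obtain m n where mn: "m \<in> C" "n \<in> C" "x m * y n - x n * y m \<noteq> 0"
    using split(2) unfolding spanning_def by auto
  have "(1 - t\<^sup>2) * (x a * y b - x b * y a) * (x m * y n - x n * y m) = 0"
    using e[OF ab(1) mn(1)] e[OF ab(1) mn(2)] e[OF ab(2) mn(1)] e[OF ab(2) mn(2)] by algebra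
  then have "t\<^sup>2 = 1" using ab mn by simp
  then show ?thesis unfolding main_loadings_agree_def using t by blast
next
  case False
  obtain p q r t where R: "basis_change g p q r t" "p * t - q * r \<noteq> 0" "s' g h \<noteq> 0"
    by (rule correlated_change_of_basis[OF assms(1-3) False])
  have hg: "h \<noteq> g" "s h g \<noteq> 0" using False symmetric(1)[of h g] assms(3) by auto
  obtain p2 q2 r2 t2 where R2: "basis_change h p2 q2 r2 t2" "p2 * t2 - q2 * r2 \<noteq> 0" "s' h g \<noteq> 0"
    by (rule correlated_change_of_basis[OF assms(2,1) hg])
  have "(p\<^sup>2 + q\<^sup>2 - 1) * x i * x j + (p * r + q * t) * x i * y j + (p * r + q * t) * y i * x j
      + (r\<^sup>2 + t\<^sup>2 - 1) * y i * y j = 0" if "i \<in> B" "j \<in> C" for i j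
  proof -
    have "gof i = g" "gof j = g" "i \<noteq> j" using that split by auto
    from change_of_basis_within[OF assms(1) R(1) this] show ?thesis by (simp add: algebra_simps)
  qed
  from bilinear_form_zero[OF split(1,2) this]
  have orth: "p\<^sup>2 + q\<^sup>2 = 1" "p * r + q * t = 0" "r\<^sup>2 + t\<^sup>2 = 1" by auto
  note A = change_of_basis_across[OF assms(1-3) R(1) R2(1)]
  define D where "D = p * t - q * r"
  have D: "D\<^sup>2 = 1" unfolding D_def using orth by algebra
  note S = second_change_of_basis[OF A, folded D_def]
  \<comment> \<open>Rewritten through \<open>R\<^sub>g\<close>, this determinant condition is \<open>b\<^sup>2 (1 - b\<^sup>2) r\<^sup>2 (a\<^sup>2 - 1) = 0\<close>.\<close>
  have sing: "(p2\<^sup>2 + q2\<^sup>2 - 1) * (r2\<^sup>2 + t2\<^sup>2 - 1) = (p2 * r2 + q2 * t2)\<^sup>2"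
    by (rule quadratic_form_singular[OF assms(2)]) (rule change_of_basis_within[OF assms(2) R2(1)])
  define a where "a = s g h"
  define b where "b = s' g h"
  have b1: "b\<^sup>2 < 1" "b \<noteq> 0" using less_one(2)[OF assms(3)] R(3) by (auto simp: b_def)
  have a1: "a\<^sup>2 < 1" using less_one(1)[OF assms(3)] by (auto simp: a_def)
  have P: "p2 = D * t" "r2 = - (D * q * a)" "b * q2 = - (D * r)" "b * t2 = D * p * a"
  proof -
    have "v = D * (D * v)" for v :: real using D by (simp add: power2_eq_square flip: mult.assoc)
    then have *: "v = D * u" if "D * v = u" for u v using that by metis
    show "p2 = D * t" "r2 = - (D * q * a)" "b * q2 = - (D * r)" "b * t2 = D * p * a"
      using S[folded a_def b_def] *[of p2 t] *[of r2 "- (q * a)"] *[of "b * q2" "- r"] *[of "b * t2" "p * a"]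
      by (simp_all add: mult.assoc mult.left_commute)
  qed
  have s1: "b\<^sup>2 * (p2\<^sup>2 + q2\<^sup>2 - 1) = (1 - b\<^sup>2) * r\<^sup>2"
  proof -
    have "b\<^sup>2 * (p2\<^sup>2 + q2\<^sup>2 - 1) = b\<^sup>2 * p2\<^sup>2 + (b * q2)\<^sup>2 - b\<^sup>2" by algebra
    also have "\<dots> = D\<^sup>2 * (b\<^sup>2 * t\<^sup>2 + r\<^sup>2) - b\<^sup>2" unfolding P by algebra
    also have "\<dots> = (1 - b\<^sup>2) * r\<^sup>2" using D orth(3) by algebra
    finally show ?thesis .
  qed
  have s2: "b\<^sup>2 * (r2\<^sup>2 + t2\<^sup>2 - 1) = a\<^sup>2 * (b\<^sup>2 * q\<^sup>2 + p\<^sup>2) - b\<^sup>2"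
  proof -
    have "b\<^sup>2 * (r2\<^sup>2 + t2\<^sup>2 - 1) = b\<^sup>2 * r2\<^sup>2 + (b * t2)\<^sup>2 - b\<^sup>2" by algebra
    also have "\<dots> = D\<^sup>2 * (a\<^sup>2 * (b\<^sup>2 * q\<^sup>2 + p\<^sup>2)) - b\<^sup>2" unfolding P by algebra
    finally show ?thesis using D by simp
  qed
  have s3: "b\<^sup>2 * (p2 * r2 + q2 * t2) = - a * ((1 - b\<^sup>2) * (r * p))"
  proof -
    have "b\<^sup>2 * (p2 * r2 + q2 * t2) = b\<^sup>2 * (p2 * r2) + (b * q2) * (b * t2)" by algebra
    also have "\<dots> = D\<^sup>2 * (- a * (b\<^sup>2 * (q * t) + r * p))" unfolding P by algebra
    also have "\<dots> = - a * ((1 - b\<^sup>2) * (r * p))" using D orth(2) by algebra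
    finally show ?thesis .
  qed
  have "b\<^sup>2 * (p2\<^sup>2 + q2\<^sup>2 - 1) * (b\<^sup>2 * (r2\<^sup>2 + t2\<^sup>2 - 1)) = (b\<^sup>2 * (p2 * r2 + q2 * t2))\<^sup>2"
    using sing by (simp add: power_mult_distrib power2_eq_square mult.assoc mult.left_commute)
  then have "(1 - b\<^sup>2) * r\<^sup>2 * (a\<^sup>2 * (b\<^sup>2 * q\<^sup>2 + p\<^sup>2) - b\<^sup>2) = (a * ((1 - b\<^sup>2) * (r * p)))\<^sup>2"
    unfolding s1 s2 s3 by simp
  then have "b\<^sup>2 * (1 - b\<^sup>2) * r\<^sup>2 * (a\<^sup>2 - 1) = 0"
    using orth(1) by algebra
  then have r0: "r = 0" using a1 b1 by auto
  then have "t \<noteq> 0" using orth by auto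
  then have "q = 0" using orth r0 by auto
  then have "p\<^sup>2 = 1" using orth by auto
  then show ?thesis unfolding main_loadings_agree_def scaled_def
    using basis_changeD(1)[OF R(1)] r0 by (intro exI[of _ p]) simp
qed

text \<open>
  Eliminating \<open>R\<^sub>h\<close> and \<open>R\<^sub>k\<close> from the three identities
  \<open>R diag R\<^sup>T = diag\<close> leaves \<open>R\<^sub>g diag(1, \<kappa>') R\<^sub>g\<^sup>T = diag(1, \<kappa>)\<close> with
  \<open>\<kappa> = s g h * s g k / s h k\<close>. So
  \<open>R\<^sub>g R\<^sub>g\<^sup>T - 1 = diag(0, \<kappa> - 1) + (1 - \<kappa>') (q, t) (q, t)\<^sup>T\<close>, whose determinant is
  \<open>(\<kappa> - 1) (1 - \<kappa>') q\<^sup>2\<close>. If this vanishes, \<open>\<kappa>' = 1\<close> is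
  impossible, since it would leave \<open>diag(0, \<kappa> - 1)\<close>, which does not vanish on two items
  with nonzero testlet loadings, and \<open>q = 0\<close> remains.
\<close>

lemma main_loadings_agree_correlated_triple:
  assumes "full_rank g" "full_rank h" "full_rank k" "g \<noteq> h" "g \<noteq> k" "h \<noteq> k"
    and "s g h \<noteq> 0" "s g k \<noteq> 0" "s h k \<noteq> 0" "s g h * s g k \<noteq> s h k"
  shows "main_loadings_agree g"
proof -
  obtain p q r t where R: "basis_change g p q r t" "p * t - q * r \<noteq> 0" "s' g h \<noteq> 0"
    by (rule correlated_change_of_basis[OF assms(1,2,4,7)])
  obtain p2 q2 r2 t2 where R2: "basis_change h p2 q2 r2 t2" "p2 * t2 - q2 * r2 \<noteq> 0" "s' h k \<noteq> 0"
    by (rule correlated_change_of_basis[OF assms(2,3,6,9)])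
  have kg: "k \<noteq> g" "s k g \<noteq> 0" using symmetric(1)[of k g] assms by auto
  obtain p3 q3 r3 t3 where R3: "basis_change k p3 q3 r3 t3" "p3 * t3 - q3 * r3 \<noteq> 0" "s' k g \<noteq> 0"
    by (rule correlated_change_of_basis[OF assms(3,1) kg])
  define a where "a = s g h"
  define b where "b = s g k"
  define c where "c = s h k"
  define a' where "a' = s' g h"
  define b' where "b' = s' g k"
  define c' where "c' = s' h k"
  note folds = a_def[symmetric] b_def[symmetric] c_def[symmetric]
    a'_def[symmetric] b'_def[symmetric] c'_def[symmetric]
  have nz: "a \<noteq> 0" "b \<noteq> 0" "c \<noteq> 0" "a' \<noteq> 0" "b' \<noteq> 0" "c' \<noteq> 0" "a * b \<noteq> c"
    using assms R(3) R2(3) R3(3) symmetric(2)[of k g] by (auto simp: a_def b_def c_def a'_def b'_def c'_def)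
  define D where "D = p * t - q * r"
  have D0: "D \<noteq> 0" using R(2) by (simp add: D_def)
  note S2 = second_change_of_basis[OF change_of_basis_across[OF assms(1,2,4) R(1) R2(1)], folded D_def, unfolded folds]
  note S3 = second_change_of_basis[OF change_of_basis_across[OF assms(1,3,5) R(1) R3(1)], folded D_def, unfolded folds]
  note A = change_of_basis_across[OF assms(2,3,6) R2(1) R3(1), unfolded folds]
  \<comment> \<open>In these terms \<open>\<kappa> = a b / c\<close> and \<open>\<kappa>' = w / c'\<close>; denominators are cleared throughout.\<close>
  define w where "w = a' * b'"
  have w0: "w \<noteq> 0" using nz w_def by auto
  have e1: "w * D\<^sup>2 = w * t\<^sup>2 + c' * r\<^sup>2"
  proof -
    have "w * D\<^sup>2 = w * D\<^sup>2 * (p2 * p3 + c' * q2 * q3)" using A(1) by simp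
    also have "\<dots> = w * (D * p2) * (D * p3) + c' * (a' * D * q2) * (b' * D * q3)"
      unfolding w_def by algebra
    finally show ?thesis using S2 S3 by (simp add: power2_eq_square)
  qed
  have e2: "w * (t * q) + c' * (r * p) = 0"
  proof -
    have "0 = w * D\<^sup>2 * (p2 * r3 + c' * q2 * t3)" using A(2) by simp
    also have "\<dots> = w * (D * p2) * (D * r3) + c' * (a' * D * q2) * (b' * D * t3)"
      unfolding w_def by algebra
    also have "\<dots> = - b * (w * (t * q) + c' * (r * p))" using S2 S3 by (simp add: algebra_simps)
    finally show ?thesis using nz by simp
  qed
  have e3: "a * b * (w * q\<^sup>2 + c' * p\<^sup>2) = c * w * D\<^sup>2"
  proof -
    have "c * w * D\<^sup>2 = w * D\<^sup>2 * (r2 * r3 + c' * t2 * t3)" using A(4) by simp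
    also have "\<dots> = w * (D * r2) * (D * r3) + c' * (a' * D * t2) * (b' * D * t3)"
      unfolding w_def by algebra
    also have "\<dots> = a * b * (w * q\<^sup>2 + c' * p\<^sup>2)" using S2 S3 by (simp add: algebra_simps power2_eq_square)
    finally show ?thesis by simp
  qed
  have "w * c' * D\<^sup>2 * (a * b) = w * D\<^sup>2 * (c * w * D\<^sup>2)"
  proof -
    have "w * c' * D\<^sup>2 = (w * t\<^sup>2 + c' * r\<^sup>2) * (w * q\<^sup>2 + c' * p\<^sup>2) - (w * (t * q) + c' * (r * p))\<^sup>2"
      unfolding D_def by algebra
    then have "w * c' * D\<^sup>2 = w * D\<^sup>2 * (w * q\<^sup>2 + c' * p\<^sup>2)" unfolding e1[symmetric] e2 by simp
    then show ?thesis using e3 by algebra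
  qed
  \<comment> \<open>Comparing determinants in the eliminated identity, which \<open>e1\<close> to \<open>e3\<close> state for the inverse of \<open>R\<^sub>g\<close>.\<close>
  then have e4: "c' * (a * b) = c * w * D\<^sup>2" using w0 D0 by simp
  have f1: "c' * p\<^sup>2 + w * q\<^sup>2 = c'" 
  proof -
    have "a * b * (c' * p\<^sup>2 + w * q\<^sup>2) = a * b * c'" using e3 e4 by (simp add: algebra_simps)
    then show ?thesis using nz by simp
  qed
  define z where "z = c' - w"
  have g1: "c' * (p\<^sup>2 + q\<^sup>2 - 1) = z * q\<^sup>2" using f1 unfolding z_def by (simp add: algebra_simps)
  have g2: "c' * (p * r + q * t) = z * (q * t)" using e2 unfolding z_def by (simp add: algebra_simps)
  have g3: "c * (c' * (r\<^sup>2 + t\<^sup>2 - 1)) = c' * (a * b - c) + c * z * t\<^sup>2"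
  proof -
    have "c * (c' * (r\<^sup>2 + t\<^sup>2 - 1)) = c * (w * t\<^sup>2 + c' * r\<^sup>2) - c * c' + c * z * t\<^sup>2"
      unfolding z_def by (simp add: algebra_simps)
    then show ?thesis using e4 unfolding e1[symmetric] by (simp add: algebra_simps)
  qed
  note form = change_of_basis_within[OF assms(1) R(1)]
  have "(p\<^sup>2 + q\<^sup>2 - 1) * (r\<^sup>2 + t\<^sup>2 - 1) = (p * r + q * t)\<^sup>2"
    by (rule quadratic_form_singular[OF assms(1)]) (rule form)
  then have "(c' * (p\<^sup>2 + q\<^sup>2 - 1)) * (c * (c' * (r\<^sup>2 + t\<^sup>2 - 1))) = c * (c' * (p * r + q * t))\<^sup>2"
    by (simp add: power2_eq_square mult.left_commute)
  then have "z * q\<^sup>2 * (c' * (a * b - c)) = 0" unfolding g1 g2 g3 by algebra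
  then have zq: "z = 0 \<or> q = 0" using nz by simp
  then have ab0: "p\<^sup>2 + q\<^sup>2 - 1 = 0" "p * r + q * t = 0" using g1 g2 nz by auto
  have "r\<^sup>2 + t\<^sup>2 - 1 = 0"
  proof (rule quadratic_form_zero[of g])
    show "(r\<^sup>2 + t\<^sup>2 - 1) * y i * y j = 0" if "gof i = g" "gof j = g" "i \<noteq> j" for i j
      using form[OF that] unfolding ab0 by simp
  qed
  then have "z \<noteq> 0" using g3 nz by auto
  then have "q = 0" using zq by simp
  then have "p\<^sup>2 = 1" "r = 0" using ab0 by auto
  then show ?thesis unfolding main_loadings_agree_def scaled_def
    using basis_changeD(1)[OF R(1)] by (intro exI[of _ p]) simp
qed

text \<open>
  For correlated testlets, \<open>x' = t x\<close> on \<open>g\<close> means that \<open>R\<^sub>g\<close> has first column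
  \<open>(t, 0)\<close>, and solving for \<open>R\<^sub>h\<close> gives \<open>1 / t\<close> as its upper left entry. The
  multiple of \<open>y\<close> stays undetermined.
\<close>

lemma scaling_crosses_testlets:
  assumes "full_rank g" "full_rank h" "g \<noteq> h" "t \<noteq> 0" and t: "scaled g t"
  obtains c where "\<forall>j. gof j = h \<longrightarrow> x' j = x j / t + c * y j"
proof (cases "s g h = 0")
  case True
  then obtain t2 where t2: "scaled g t2" "scaled h (1 / t2)"
    using uncorrelated_scaling[OF assms(1-3) True] by blast
  obtain k where k: "gof k = g" "x k \<noteq> 0" using spanning_nonzero[OF assms(1)] by auto
  have "t2 = t" using scaledD[OF t k(1)] scaledD[OF t2(1) k(1)] k by simp
  then show ?thesis using that[of 0] t2(2) by (simp add: scaled_def)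
next
  case False
  obtain p q r u where R: "basis_change g p q r u" "p * u - q * r \<noteq> 0" "s' g h \<noteq> 0"
    by (rule correlated_change_of_basis[OF assms(1-3) False])
  have hg: "h \<noteq> g" "s h g \<noteq> 0" using False symmetric(1)[of h g] assms(3) by auto
  obtain p2 q2 r2 u2 where R2: "basis_change h p2 q2 r2 u2" "p2 * u2 - q2 * r2 \<noteq> 0" "s' h g \<noteq> 0"
    by (rule correlated_change_of_basis[OF assms(2,1) hg])
  have "(p - t) * x i + r * y i = 0" if "i \<in> gof -` {g}" for i
    using basis_changeD(1)[OF R(1), of i] scaledD[OF t, of i] that by (simp add: algebra_simps)
  from linear_form_zero[OF assms(1) this] have pr: "p = t" "r = 0" by auto
  note A = change_of_basis_across[OF assms(1-3) R(1) R2(1)]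
  have "p2 = 1 / t"
    using second_change_of_basis(1)[OF A] A(4) pr assms(4) False by (auto simp: field_simps)
  then show ?thesis using that[of r2] basis_changeD(1)[OF R2(1)] by simp
qed

text \<open>
  Crossing into \<open>k\<close> from \<open>g\<close>, where \<open>x' = t x\<close>, and from \<open>h\<close>, where
  \<open>x' = x / t\<close>, gives the coefficients \<open>1 / t\<close> and \<open>t\<close> for the same rows.
\<close>

lemma main_loadings_agree_uncorrelated_pair:
  assumes "full_rank g" "full_rank h" "full_rank k" "g \<noteq> h" "g \<noteq> k" "h \<noteq> k" "s g h = 0"
  shows "main_loadings_agree g"
proof -
  obtain t where t: "t \<noteq> 0" "scaled g t" "scaled h (1 / t)"
    by (rule uncorrelated_scaling[OF assms(1,2,4,7)])
  obtain c where c: "\<forall>j. gof j = k \<longrightarrow> x' j = x j / t + c * y j"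
    by (rule scaling_crosses_testlets[OF assms(1,3,5) t(1,2)])
  have t': "1 / t \<noteq> 0" using t by simp
  obtain e where e: "\<forall>j. gof j = k \<longrightarrow> x' j = x j / (1 / t) + e * y j"
    by (rule scaling_crosses_testlets[OF assms(2,3,6) t' t(3)])
  have "(1 / t - t) * x j + (c - e) * y j = 0" if "j \<in> gof -` {k}" for j
    using c e that t(1) by (simp add: field_simps)
  from linear_form_zero[OF assms(3) this] have "t\<^sup>2 = 1"
    using t(1) by (simp add: power2_eq_square field_simps)
  then show ?thesis unfolding main_loadings_agree_def using t(2) by blast
qed

text \<open>
  If all three covariances are nonzero, the exceptional equation
  \<open>s g h * s g k = s h k\<close> cannot hold for two of the testlets at once: together with
  \<open>s g h * s h k = s g k\<close> it would give \<open>(s g h)\<^sup>2 = 1\<close>.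
\<close>

lemma main_loadings_agree_triple:
  assumes "full_rank g" "full_rank h" "full_rank k" "g \<noteq> h" "g \<noteq> k" "h \<noteq> k"
  shows "\<exists>l. full_rank l \<and> main_loadings_agree l"
proof -
  consider "s g h = 0" | "s g k = 0" | "s h k = 0"
    | "s g h \<noteq> 0" "s g k \<noteq> 0" "s h k \<noteq> 0" by blast
  then show ?thesis
  proof cases
    case 1 then show ?thesis using main_loadings_agree_uncorrelated_pair[of g h k] assms by metis
  next
    case 2 then show ?thesis using main_loadings_agree_uncorrelated_pair[of g k h] assms by metis
  next
    case 3 then show ?thesis using main_loadings_agree_uncorrelated_pair[of h k g] assms by metis
  next
    case 4
    show ?thesis
    proof (cases "s g h * s g k = s h k")
      case False
      then show ?thesis using main_loadings_agree_correlated_triple[of g h k] assms 4 by metis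
    next
      case True
      have "s h g * s h k \<noteq> s g k"
      proof
        assume "s h g * s h k = s g k"
        then have "((s g h)\<^sup>2 - 1) * s g k = 0" using True symmetric(1)[of h g] by (simp add: power2_eq_square algebra_simps)
        then show False using 4 less_one(1)[OF assms(4)] by auto
      qed
      then have "main_loadings_agree h"
        using main_loadings_agree_correlated_triple[of h g k] assms 4 symmetric(1)[of h g] by metis
      then show ?thesis using assms by blast
    qed
  qed
qed

text \<open>
  Because the rows of \<open>g\<close> span the plane, comparing coefficients of \<open>x\<close> in the correlations
  between \<open>g\<close> and an item \<open>j\<close> elsewhere gives \<open>x j = t * x' j\<close>. After that the products
  of testlet loadings agree within every testlet.
\<close>

lemma all_agree_up_to_sign:
  assumes "full_rank g" "main_loadings_agree g"
  obtains t e where "t\<^sup>2 = 1" "\<And>i. x' i = t * x i"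
    "\<And>h. (e h)\<^sup>2 = 1" "\<And>i. y' i = e (gof i) * y i" "\<And>h k. s' h k = e h * e k * s h k"
proof -
  obtain t where t: "t\<^sup>2 = 1" "\<And>i. gof i = g \<Longrightarrow> x' i = t * x i"
    using assms(2) unfolding main_loadings_agree_def scaled_def by auto
  have sign: "\<exists>e. e\<^sup>2 = 1 \<and> (\<forall>i. gof i = h \<longrightarrow> y' i = e * y i)"
    if xh: "\<And>i. gof i = h \<Longrightarrow> x' i = t * x i" for h
  proof -
    have "y i * y j = y' i * y' j" if "gof i = h" "gof j = h" "i \<noteq> j" for i j
      using within[OF that] xh[OF that(1)] xh[OF that(2)] t(1) by algebra
    from same_up_to_sign_if_off_diagonal[OF this] show ?thesis by metis
  qed
  obtain e where e: "e\<^sup>2 = 1" "\<And>i. gof i = g \<Longrightarrow> y' i = e * y i" using sign[OF t(2)] by blast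
  have X: "x' j = t * x j" for j
  proof (cases "gof j = g")
    case False
    have "(x j - t * x' j) * x i + (s g (gof j) * y j - s' g (gof j) * e * y' j) * y i = 0"
      if "i \<in> gof -` {g}" for i
      using across[of i g j "gof j"] that False t(2)[of i] e(2)[of i] by (simp add: algebra_simps)
    from linear_form_zero[OF assms(1) this] have "x j = t * x' j" by simp
    then show ?thesis using t(1) by algebra
  qed (use t in auto)
  have "\<exists>e. e\<^sup>2 = 1 \<and> (\<forall>i. gof i = h \<longrightarrow> y' i = e * y i)" for h by (rule sign) (rule X)
  then obtain e where e: "\<And>h. (e h)\<^sup>2 = 1" "\<And>h i. gof i = h \<Longrightarrow> y' i = e h * y i" by metis
  have "s' h k = e h * e k * s h k" for h k
  proof (cases "h = k")
    case True
    then show ?thesis using e(1)[of k] unit_diag by (simp add: power2_eq_square)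
  next
    case False
    obtain i where i: "gof i = h" "y i \<noteq> 0" by (rule third_loading)
    obtain j where j: "gof j = k" "y j \<noteq> 0" by (rule third_loading)
    have "(s h k - s' h k * (e h * e k)) * (y i * y j) = 0"
      using across[OF i(1) j(1) False] X[of i] X[of j] e(2)[OF i(1)] e(2)[OF j(1)] t(1) by algebra
    then have "s h k = s' h k * (e h * e k)" using i j by simp
    then show ?thesis using e(1)[of h] e(1)[of k] by algebra
  qed
  then show ?thesis using that t(1) X e by blast
qed

end

section \<open>Identifiability\<close>

lemma pos_def_unit_diag_less_one:
  fixes S :: "real^'n^'n"
  assumes pd: "pos_def_matrix S" and diag: "\<And>g. S $ g $ g = 1" and "g \<noteq> h"
  shows "(S $ g $ h)\<^sup>2 < 1"
proof -
  define s where "s = S $ g $ h"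
  have entry: "axis a 1 \<bullet> (S *v axis b 1) = S $ a $ b" for a b
    by (simp add: inner_axis' matrix_vector_mult_basis column_def)
  have sym: "S $ h $ g = s"
    using pos_def_sym[OF pd, of "axis h 1" "axis g 1"] unfolding entry s_def .
  define x :: "real^'n" where "x = axis g 1 - s *\<^sub>R axis h 1"
  have "x $ g = 1" using \<open>g \<noteq> h\<close> by (simp add: x_def axis_def)
  then have "x \<noteq> 0" by (metis zero_index zero_neq_one)
  then have "0 < x \<bullet> (S *v x)" using pd by (simp add: pos_def_matrix_def)
  also have "x \<bullet> (S *v x) = 1 - s\<^sup>2"
    unfolding x_def
    by (simp add: matrix_vector_mult_diff_distrib matrix_vector_mult_scaleR inner_diff entry sym diag
        power2_eq_square flip: s_def)
  finally show ?thesis by (simp add: s_def)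
qed

text \<open>
  Standardisation rescales the rows by positive factors and so preserves collinearity. Collinear
  rows \<open>u i *\<^sub>R (a, b)\<close> have the kernel vector \<open>(b, - a)\<close>, or any nonzero vector if
  \<open>a = b = 0\<close>.
\<close>

lemma spanning_if_rank_2:
  assumes rank: "rank (loading_submatrix A g B) = 2" and B: "\<And>j. j \<in> B \<Longrightarrow> gof j = g"
  shows "spanning (main_std gof A) (testlet_std gof A) B"
proof (rule ccontr)
  assume "\<not> ?thesis"
  then obtain u :: "'a \<Rightarrow> real" and a b where u: "\<And>i. i \<in> B \<Longrightarrow> main_std gof A i = u i * a"
    "\<And>i. i \<in> B \<Longrightarrow> testlet_std gof A i = u i * b"
    using collinear_representation by metis
  have raw: "A $ i $ None = item_scale gof A i * u i * a" "A $ i $ Some g = item_scale gof A i * u i * b"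
    if "i \<in> B" for i
    using u[OF that] B[OF that] item_scale_pos[of gof A i]
    by (auto simp: main_std_def testlet_std_def field_simps)
  define z :: "real^2" where "z = (if a = 0 \<and> b = 0 then vector [1, 0] else vector [b, - a])"
  have "z \<noteq> 0" by (auto simp: z_def vec_eq_iff forall_2)
  moreover have "loading_submatrix A g B *v z = 0"
    by (auto simp: vec_eq_iff matrix_vector_mult_def loading_submatrix_def sum_2 z_def raw)
  ultimately have "rank (loading_submatrix A g B) \<noteq> CARD(2)"
    using matrix_nonfull_linear_equations_eq by blast
  then show False using rank by simp
qed

text \<open>
  A column and its multiple by \<open>c\<close> have their first nonzero entry at the same place, where the
  sign convention makes both positive.
\<close>

lemma first_nonzero_sign:
  fixes a b :: "real^('j::{finite,linorder})"
  assumes a: "first_nonzero_pos a" and b: "first_nonzero_pos b"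
    and eq: "\<And>j. b $ j = c * a $ j" and nz: "a $ l \<noteq> 0" and c: "c\<^sup>2 = 1"
  shows "c = 1"
proof -
  define j where "j = Min {j. a $ j \<noteq> 0}"
  have ne: "{j. a $ j \<noteq> 0} \<noteq> {}" using nz by auto
  have j: "a $ j \<noteq> 0" using Min_in[OF _ ne] by (simp add: j_def)
  have below: "a $ i = 0" if "i < j" for i
  proof (rule ccontr)
    assume "a $ i \<noteq> 0"
    then have "j \<le> i" unfolding j_def by (intro Min_le) auto
    then show False using that by simp
  qed
  have "c \<noteq> 0" using c by auto
  have "a $ j > 0" using a j below by (auto simp: first_nonzero_pos_def)
  moreover have "b $ j > 0"
  proof -
    have "b $ j \<noteq> 0" using eq[of j] j \<open>c \<noteq> 0\<close> by simp
    moreover have "\<forall>i<j. b $ i = 0" using eq below by simp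
    ultimately show ?thesis using b by (auto simp: first_nonzero_pos_def)
  qed
  ultimately have "c > 0" using eq[of j] by (simp add: zero_less_mult_iff)
  then show ?thesis using c by (simp add: power2_eq_1_iff)
qed

text \<open>
  This recovers the scale, and with it the raw parameters, from the standardised loadings.
\<close>

lemma std_loadings_norm:
  "(main_std gof A j)\<^sup>2 + (testlet_std gof A j)\<^sup>2 = 1 - 1 / (item_scale gof A j)\<^sup>2"
proof -
  have "(item_scale gof A j)\<^sup>2 = 1 + (A $ j $ None)\<^sup>2 + (A $ j $ Some (gof j))\<^sup>2"
    unfolding item_scale_def by (simp add: add_nonneg_nonneg)
  then have "(main_std gof A j)\<^sup>2 + (testlet_std gof A j)\<^sup>2 = ((item_scale gof A j)\<^sup>2 - 1) / (item_scale gof A j)\<^sup>2"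
    by (simp add: main_std_def testlet_std_def power_divide add_divide_distrib)
  then show ?thesis using item_scale_pos[of gof A j] by (simp add: diff_divide_distrib)
qed

theorem theorem7:
  fixes gof :: "'j::{finite,linorder} \<Rightarrow> 'g::finite"
    and A :: "real^('g option)^('j::{finite,linorder})" and d :: "real^('j::{finite,linorder})" and SG :: "real^'g^'g"
  assumes "surj gof"
    and "(A, d, SG) \<in> param_space gof"
    and "((\<forall>g. card (Q_set A g) \<ge> 3) \<and> card (H3_set gof A) \<ge> 3) \<or>
         ((\<forall>g. card (Q_set A g) \<ge> 3) \<and> card (H3_set gof A) = 2 \<and> card (H2_set gof A) \<ge> 1)"
  shows "identifiable_at gof (A, d, SG)"
  unfolding identifiable_at_def
proof (intro ballI impI)
  fix p'
  assume p': "p' \<in> param_space gof"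
    and eq: "response_distribution gof p' = response_distribution gof (A, d, SG)"
  obtain A' d' SG' where p'_eq: "p' = (A', d', SG')" by (cases p')
  note p' = p'[unfolded p'_eq] and p = assms(2)
  have space: "(\<forall>j g. g \<noteq> gof j \<longrightarrow> B $ j $ Some g = 0) \<and> pos_def_matrix S \<and> (\<forall>g. S $ g $ g = 1)
      \<and> (\<forall>k. first_nonzero_pos (column k B))" if "(B, e, S) \<in> param_space gof" for B e S
    using that by (simp add: param_space_def)
  have sparse: "A $ j $ Some g = 0" "A' $ j $ Some g = 0" if "g \<noteq> gof j" for j g
    using space[OF p] space[OF p'] that by auto
  have Sigma: "pos_def_matrix SG" "pos_def_matrix SG'" "\<And>g. SG $ g $ g = 1" "\<And>g. SG' $ g $ g = 1"
    and pos: "\<And>k. first_nonzero_pos (column k A)" "\<And>k. first_nonzero_pos (column k A')"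
    using space[OF p] space[OF p'] by auto
  have testlet: "testlet_std gof A j \<noteq> 0 \<longleftrightarrow> A $ j $ Some (gof j) \<noteq> 0" for j
    using item_scale_pos[of gof A j] by (simp add: testlet_std_def)
  have Q: "{j. gof j = g \<and> testlet_std gof A j \<noteq> 0} = Q_set A g" for g
    unfolding Q_set_def testlet using sparse(1)[of g] by (intro Collect_cong) metis
  note poly = response_determines_polychoric[OF p p' eq[unfolded p'_eq]]
  interpret equivalent_loadings gof "main_std gof A" "testlet_std gof A" "main_std gof A'" "testlet_std gof A'"
    "\<lambda>g h. SG $ g $ h" "\<lambda>g h. SG' $ g $ h"
  proof
    show "3 \<le> card {j. gof j = g \<and> testlet_std gof A j \<noteq> 0}" for g
      using assms(3) unfolding Q by auto
    show "SG $ g $ h = SG $ h $ g" "SG' $ g $ h = SG' $ h $ g" for g h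
      by (rule pos_def_entry_sym[OF Sigma(1)], rule pos_def_entry_sym[OF Sigma(2)])
    show "(SG $ g $ h)\<^sup>2 < 1" "(SG' $ g $ h)\<^sup>2 < 1" if "g \<noteq> h" for g h
      using pos_def_unit_diag_less_one[OF Sigma(1,3) that] pos_def_unit_diag_less_one[OF Sigma(2,4) that]
      by auto
  qed (use poly(2) Sigma(3,4) in \<open>simp_all add: item_correlation_def\<close>)
  have full_rank: "full_rank g" if "g \<in> H3_set gof A" for g
  proof -
    have "spanning (main_std gof A) (testlet_std gof A) (testlet gof g)"
      by (rule spanning_if_rank_2[of A g]) (use that in \<open>auto simp: H3_set_def testlet_def\<close>)
    moreover have "testlet gof g = gof -` {g}" by (auto simp: testlet_def)
    ultimately show ?thesis by simp
  qed
  have "\<exists>g. full_rank g \<and> main_loadings_agree g"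
  proof (cases "card (H3_set gof A) \<ge> 3")
    case True
    then obtain T where T: "T \<subseteq> H3_set gof A" "card T = 3"
      by (metis obtain_subset_with_card_n)
    obtain g h k where ghk: "T = {g, h, k}" "g \<noteq> h" "h \<noteq> k" "g \<noteq> k"
      using T(2) by (metis card_3_iff)
    then have "full_rank g" "full_rank h" "full_rank k" using T(1) full_rank by simp_all
    from main_loadings_agree_triple[OF this ghk(2,4,3)] show ?thesis .
  next
    case False
    then have "card (H3_set gof A) = 2" "card (H2_set gof A) \<ge> 1" using assms(3) by auto
    then have "H2_set gof A \<noteq> {}" by force
    then obtain g where "g \<in> H2_set gof A" by blast
    then obtain B C where BC: "B \<union> C = testlet gof g" "B \<inter> C = {}"
      "rank (loading_submatrix A g B) = 2" "rank (loading_submatrix A g C) = 2"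
      unfolding H2_set_def by blast
    have sub: "B \<union> C \<subseteq> gof -` {g}" using BC(1) by (auto simp: testlet_def)
    have sp: "spanning (main_std gof A) (testlet_std gof A) B" "spanning (main_std gof A) (testlet_std gof A) C"
      by (rule spanning_if_rank_2[of A g]; use BC sub in auto)+
    then have "full_rank g" using sub unfolding spanning_def by (meson UnI1 subsetD)
    have "\<not> H3_set gof A \<subseteq> {g}"
      using \<open>card (H3_set gof A) = 2\<close> card_mono[of "{g}" "H3_set gof A"] by auto
    then obtain h where h: "h \<in> H3_set gof A" "g \<noteq> h" by blast
    from main_loadings_agree_split_testlet[OF \<open>full_rank g\<close> full_rank[OF h(1)] h(2) sp BC(2) sub]
    show ?thesis using \<open>full_rank g\<close> by blast
  qed
  then obtain g0 where g0: "full_rank g0" "main_loadings_agree g0" by blast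
  then obtain t e where te: "t\<^sup>2 = 1" "\<And>i. main_std gof A' i = t * main_std gof A i"
    "\<And>h. (e h)\<^sup>2 = 1" "\<And>i. testlet_std gof A' i = e (gof i) * testlet_std gof A i"
    "\<And>h k. SG' $ h $ k = e h * e k * SG $ h $ k"
    using all_agree_up_to_sign[OF g0] by blast
  have scale: "item_scale gof A' j = item_scale gof A j" for j
  proof -
    have "(main_std gof A' j)\<^sup>2 + (testlet_std gof A' j)\<^sup>2 = (main_std gof A j)\<^sup>2 + (testlet_std gof A j)\<^sup>2"
      by (simp add: te power_mult_distrib)
    then have "(item_scale gof A' j)\<^sup>2 = (item_scale gof A j)\<^sup>2" unfolding std_loadings_norm by simp
    then show ?thesis using item_scale_pos[of gof A j] item_scale_pos[of gof A' j]
      by (simp add: power2_eq_iff_nonneg)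
  qed
  have A'_main: "A' $ j $ None = t * A $ j $ None" for j
    using te(2)[of j] item_scale_pos[of gof A j] by (simp add: main_std_def scale field_simps)
  have A'_testlet: "A' $ j $ Some g = e g * A $ j $ Some g" for j g
  proof (cases "g = gof j")
    case True
    then show ?thesis
      using te(4)[of j] item_scale_pos[of gof A j] by (simp add: testlet_std_def scale field_simps)
  qed (simp add: sparse)
  have "t = 1"
  proof -
    obtain l where "main_std gof A l \<noteq> 0" using spanning_nonzero[OF g0(1)] by blast
    then have "column None A $ l \<noteq> 0" by (auto simp: main_std_def column_def)
    then show ?thesis
      using first_nonzero_sign[OF pos(1) pos(2), of None t None l] A'_main te(1) by (simp add: column_def)
  qed
  have e1: "e g = 1" for g
  proof -
    obtain l where l: "gof l = g" "testlet_std gof A l \<noteq> 0" by (rule third_loading)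
    then have "column (Some g) A $ l \<noteq> 0" by (auto simp: testlet_std_def column_def)
    then show ?thesis
      using first_nonzero_sign[OF pos(1) pos(2), of "Some g" "e g" "Some g" l] A'_testlet te(3)
      by (simp add: column_def)
  qed
  have "A' $ j $ k = A $ j $ k" for j k
    by (cases k) (simp_all add: A'_main A'_testlet \<open>t = 1\<close> e1)
  then have "A' = A" by (simp add: vec_eq_iff)
  moreover have "d' = d"
    using poly(1) item_scale_pos[of gof A] by (simp add: vec_eq_iff scale less_imp_neq[symmetric])
  moreover have "SG' = SG" by (simp add: vec_eq_iff te(5) e1)
  ultimately show "p' = (A, d, SG)" by (simp add: p'_eq)
qed

end
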